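(* Let $\mathbb{E}$ be a regular category and let $n\geq 2$ be an integer. The following conditions are equivalent: 1) the category $\mathbb{E}$ is congruence $n$-permutable; 2) the category $\mathbb{E}$ satisfies the mixed $(2n-1)$-subpermutability condition, i.e. $(S,R)_{2n-1}\subset(R,S)_{2n-1}$ for every pair $(R,S)$ of a preorder $R$ and a reflexive relation $S$ on the same object.
   Context: A relation on $X$ is (a class up to isomorphism of) a subobject $R\rightarrowtail X\times X$, ordered by inclusion. In a regular category relations compose: $SR=S\circ R$ is the usual composite relation ($x(SR)z$ iff there is $y$ with $xRy$ and $ySz$), defined by a pullback followed by the regular epi–mono factorization. $R$ is reflexive if $\Delta_X\subset R$, symmetric if $R^{op}\subset R$, transitive if $R\circ R\subset R$; a preorder is a reflexive transitive relation, an equivalence relation is a symmetric preorder. For reflexive relations $R,S$ on $X$, $(R,S)_k$ is the alternating product of $k$ factors beginning with $R$: $(R,S)_1=R$, $(R,S)_2=RS$, $(R,S)_3=RSR$, etc. A regular category is congruence $n$-permutable when $(R,S)_n=(S,R)_n$ for any pair $(R,S)$ of equivalence relations on the same object. *)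

theory Defs
  imports Main
begin

record ('o, 'm) cat =
  Obj :: "'o set"
  Arr :: "'m set"
  Dom :: "'m \<Rightarrow> 'o"
  Cod :: "'m \<Rightarrow> 'o"
  Ident :: "'o \<Rightarrow> 'm"
  Comp :: "'m \<Rightarrow> 'm \<Rightarrow> 'm" (infixl \<open>\<cdot>\<index>\<close> 70)

locale category =
  fixes C :: "('o, 'm) cat" (structure)
  assumes Dom_Obj: "f \<in> Arr C \<Longrightarrow> Dom C f \<in> Obj C"
    and Cod_Obj: "f \<in> Arr C \<Longrightarrow> Cod C f \<in> Obj C"
    and Ident_Arr: "X \<in> Obj C \<Longrightarrow> Ident C X \<in> Arr C"
    and Dom_Ident: "X \<in> Obj C \<Longrightarrow> Dom C (Ident C X) = X"
    and Cod_Ident: "X \<in> Obj C \<Longrightarrow> Cod C (Ident C X) = X"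
    and Comp_Arr: "\<lbrakk>f \<in> Arr C; g \<in> Arr C; Cod C f = Dom C g\<rbrakk> \<Longrightarrow> g \<cdot> f \<in> Arr C"
    and Dom_Comp: "\<lbrakk>f \<in> Arr C; g \<in> Arr C; Cod C f = Dom C g\<rbrakk> \<Longrightarrow> Dom C (g \<cdot> f) = Dom C f"
    and Cod_Comp: "\<lbrakk>f \<in> Arr C; g \<in> Arr C; Cod C f = Dom C g\<rbrakk> \<Longrightarrow> Cod C (g \<cdot> f) = Cod C g"
    and Comp_Ident: "f \<in> Arr C \<Longrightarrow> f \<cdot> Ident C (Dom C f) = f"
    and Ident_Comp: "f \<in> Arr C \<Longrightarrow> Ident C (Cod C f) \<cdot> f = f"
    and Comp_assoc: "\<lbrakk>f \<in> Arr C; g \<in> Arr C; h \<in> Arr C; Cod C f = Dom C g; Cod C g = Dom C h\<rbrakk>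
          \<Longrightarrow> h \<cdot> (g \<cdot> f) = (h \<cdot> g) \<cdot> f"
begin

definition hom :: "'o \<Rightarrow> 'o \<Rightarrow> 'm set" where
  "hom A B = {f \<in> Arr C. Dom C f = A \<and> Cod C f = B}"

definition monic :: "'m \<Rightarrow> bool" where
  "monic m \<longleftrightarrow> m \<in> Arr C \<and>
     (\<forall>A. \<forall>f \<in> hom A (Dom C m). \<forall>g \<in> hom A (Dom C m). m \<cdot> f = m \<cdot> g \<longrightarrow> f = g)"

definition iso :: "'m \<Rightarrow> bool" where
  "iso f \<longleftrightarrow> f \<in> Arr C \<and>
     (\<exists>g \<in> hom (Cod C f) (Dom C f). g \<cdot> f = Ident C (Dom C f) \<and> f \<cdot> g = Ident C (Cod C f))"

definition is_terminal :: "'o \<Rightarrow> bool" where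
  "is_terminal T \<longleftrightarrow> T \<in> Obj C \<and> (\<forall>A \<in> Obj C. \<exists>!f. f \<in> hom A T)"

definition is_product :: "'o \<Rightarrow> 'o \<Rightarrow> 'o \<Rightarrow> 'm \<Rightarrow> 'm \<Rightarrow> bool" where
  "is_product A B P p q \<longleftrightarrow> p \<in> hom P A \<and> q \<in> hom P B \<and>
     (\<forall>Z. \<forall>f \<in> hom Z A. \<forall>g \<in> hom Z B. \<exists>!u. u \<in> hom Z P \<and> p \<cdot> u = f \<and> q \<cdot> u = g)"

definition is_pullback :: "'m \<Rightarrow> 'm \<Rightarrow> 'm \<Rightarrow> 'm \<Rightarrow> bool" where
  "is_pullback f g p q \<longleftrightarrow> f \<in> Arr C \<and> g \<in> Arr C \<and> Cod C f = Cod C g \<and>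
     p \<in> hom (Dom C p) (Dom C f) \<and> q \<in> hom (Dom C p) (Dom C g) \<and> f \<cdot> p = g \<cdot> q \<and>
     (\<forall>Z. \<forall>h \<in> hom Z (Dom C f). \<forall>k \<in> hom Z (Dom C g). f \<cdot> h = g \<cdot> k \<longrightarrow>
        (\<exists>!u. u \<in> hom Z (Dom C p) \<and> p \<cdot> u = h \<and> q \<cdot> u = k))"

definition is_coequalizer :: "'m \<Rightarrow> 'm \<Rightarrow> 'm \<Rightarrow> bool" where
  "is_coequalizer f g e \<longleftrightarrow> f \<in> Arr C \<and> g \<in> hom (Dom C f) (Cod C f) \<and>
     e \<in> hom (Cod C f) (Cod C e) \<and> e \<cdot> f = e \<cdot> g \<and>
     (\<forall>Z. \<forall>h \<in> hom (Cod C f) Z. h \<cdot> f = h \<cdot> g \<longrightarrow> (\<exists>!u. u \<in> hom (Cod C e) Z \<and> u \<cdot> e = h))"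

definition regular_epi :: "'m \<Rightarrow> bool" where
  "regular_epi e \<longleftrightarrow> (\<exists>f g. is_coequalizer f g e)"

text \<open>Binary products are chosen once and for all, and so are the projections.\<close>

definition prod_cone :: "'o \<Rightarrow> 'o \<Rightarrow> 'o \<times> 'm \<times> 'm" where
  "prod_cone A B = (SOME (P, p, q). is_product A B P p q)"

definition prd :: "'o \<Rightarrow> 'o \<Rightarrow> 'o" where "prd A B = fst (prod_cone A B)"
definition pr1 :: "'o \<Rightarrow> 'o \<Rightarrow> 'm" where "pr1 A B = fst (snd (prod_cone A B))"
definition pr2 :: "'o \<Rightarrow> 'o \<Rightarrow> 'm" where "pr2 A B = snd (snd (prod_cone A B))"

definition tuple :: "'o \<Rightarrow> 'm \<Rightarrow> 'm \<Rightarrow> 'm" where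
  "tuple X f g = (THE u. u \<in> hom (Dom C f) (prd X X) \<and> pr1 X X \<cdot> u = f \<and> pr2 X X \<cdot> u = g)"

definition factors_through :: "'m \<Rightarrow> 'm \<Rightarrow> bool" where
  "factors_through m m' \<longleftrightarrow> (\<exists>u \<in> hom (Dom C m) (Dom C m'). m = m' \<cdot> u)"

text \<open>A subobject is an isomorphism class, i.e. the set of all monomorphisms representing it;
  equality of subobjects, and hence of relations, is therefore equality in HOL.\<close>

definition subobj :: "'m \<Rightarrow> 'm set" where
  "subobj m = {m'. monic m' \<and> (\<exists>u \<in> hom (Dom C m') (Dom C m). iso u \<and> m' = m \<cdot> u)}"

definition rels :: "'o \<Rightarrow> 'm set set" where
  "rels X = {subobj m |m. monic m \<and> Cod C m = prd X X}"

definition incl :: "'m set \<Rightarrow> 'm set \<Rightarrow> bool" where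
  "incl R S \<longleftrightarrow> (\<exists>r \<in> R. \<exists>s \<in> S. factors_through r s)"

definition diag :: "'o \<Rightarrow> 'm set" where
  "diag X = subobj (tuple X (Ident C X) (Ident C X))"

definition opp :: "'o \<Rightarrow> 'm set \<Rightarrow> 'm set" where
  "opp X R = (\<lambda>r. tuple X (pr2 X X \<cdot> r) (pr1 X X \<cdot> r)) ` R"

text \<open>The composite \<open>S \<circ> R\<close> (first \<open>R\<close>, then \<open>S\<close>): the monomorphic part \<open>m\<close> of a
  factorization \<open>m \<cdot> e\<close> of the arrow into \<open>X \<times> X\<close> induced by a pullback of
  the second leg of \<open>R\<close> and the first leg of \<open>S\<close>. All choices of representatives, pullback and
  factorization are collected; they make up exactly one isomorphism class.\<close>

definition relcomp :: "'o \<Rightarrow> 'm set \<Rightarrow> 'm set \<Rightarrow> 'm set" where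
  "relcomp X S R = {m. monic m \<and> (\<exists>r \<in> R. \<exists>s \<in> S. \<exists>a b e.
      is_pullback (pr2 X X \<cdot> r) (pr1 X X \<cdot> s) a b \<and>
      regular_epi e \<and> Cod C e = Dom C m \<and>
      m \<cdot> e = tuple X (pr1 X X \<cdot> r \<cdot> a) (pr2 X X \<cdot> s \<cdot> b))}"

definition reflexive_rel :: "'o \<Rightarrow> 'm set \<Rightarrow> bool" where
  "reflexive_rel X R \<longleftrightarrow> R \<in> rels X \<and> incl (diag X) R"

definition symmetric_rel :: "'o \<Rightarrow> 'm set \<Rightarrow> bool" where
  "symmetric_rel X R \<longleftrightarrow> R \<in> rels X \<and> incl (opp X R) R"

definition transitive_rel :: "'o \<Rightarrow> 'm set \<Rightarrow> bool" where
  "transitive_rel X R \<longleftrightarrow> R \<in> rels X \<and> incl (relcomp X R R) R"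

definition preorder_rel :: "'o \<Rightarrow> 'm set \<Rightarrow> bool" where
  "preorder_rel X R \<longleftrightarrow> reflexive_rel X R \<and> transitive_rel X R"

definition equivalence_rel :: "'o \<Rightarrow> 'm set \<Rightarrow> bool" where
  "equivalence_rel X R \<longleftrightarrow> preorder_rel X R \<and> symmetric_rel X R"

text \<open>\<open>altprod X k R S\<close> is \<open>(R,S)\<^sub>k = R \<circ> S \<circ> R \<circ> \<dots>\<close> with \<open>k\<close> factors, \<open>R\<close> being the leftmost
  one. The value at \<open>k = 0\<close> is the empty composite.\<close>

fun altprod :: "'o \<Rightarrow> nat \<Rightarrow> 'm set \<Rightarrow> 'm set \<Rightarrow> 'm set" where
  "altprod X 0 R S = diag X"
| "altprod X (Suc 0) R S = R"
| "altprod X (Suc (Suc k)) R S = relcomp X R (altprod X (Suc k) S R)"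

definition congruence_permutable :: "nat \<Rightarrow> bool" where
  "congruence_permutable n \<longleftrightarrow> (\<forall>X \<in> Obj C. \<forall>R S. equivalence_rel X R \<and> equivalence_rel X S \<longrightarrow>
     altprod X n R S = altprod X n S R)"

definition mixed_subpermutable :: "nat \<Rightarrow> bool" where
  "mixed_subpermutable k \<longleftrightarrow> (\<forall>X \<in> Obj C. \<forall>R S. preorder_rel X R \<and> reflexive_rel X S \<longrightarrow>
     incl (altprod X k S R) (altprod X k R S))"

end

text \<open>Regular categories in the sense of Barr. Finite completeness is given by a terminal object
  and pullbacks.\<close>

locale regular_category = category +
  assumes terminal_exists: "\<exists>T. is_terminal T"
    and pullback_exists: "\<lbrakk>f \<in> Arr C; g \<in> Arr C; Cod C f = Cod C g\<rbrakk> \<Longrightarrow> \<exists>p q. is_pullback f g p q"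
    and kernel_pair_coequalizer: "is_pullback f f p q \<Longrightarrow> \<exists>e. is_coequalizer p q e"
    and regular_epi_pullback: "\<lbrakk>is_pullback f g p q; regular_epi g\<rbrakk> \<Longrightarrow> regular_epi p"

end

theory Submission
  imports Defs
begin

text \<open>
  Everything is read off from generalized elements: \<open>holds X R a b\<close> says that the pair of arrows
  \<open>a, b : U \<rightarrow> X\<close> factors through the relation \<open>R\<close>. Two relations are equal when they hold of the
  same pairs (\<open>incl_iff\<close>, \<open>incl_antisym\<close>); \<open>holds\<close> may be checked after precomposition with a
  composite of regular epimorphisms (\<open>holds_local\<close>); and a composite relation holds of \<open>a, c\<close> exactly
  when, after such a covering, there is a middle element (\<open>relcomp_rel\<close>). Hence \<open>(R,S)\<^sub>k\<close> holds of
  \<open>a, b\<close> exactly when \<open>a\<close> and \<open>b\<close> are joined, after a covering, by a chain of \<open>k\<close> steps alternating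
  between \<open>R\<close> and \<open>S\<close> (\<open>holds_altprodI\<close>, \<open>holds_altprodE\<close>), and one argues as with sets.

  Both conditions of the theorem are equivalent to \<open>E\<^sup>n \<subseteq> E\<^sup>n\<^sup>-\<^sup>1\<close> for all reflexive relations \<open>E\<close>,
  where \<open>E\<^sup>k = (E,E)\<^sub>k\<close>.

  If congruences \<open>n\<close>-permute and \<open>E\<close> is reflexive, consider the object \<open>Z\<close> of \<open>E\<close>-chains with \<open>n\<close>
  entries and on it the two congruences ``same entries at even places'' and ``same entries at odd
  places''. An \<open>E\<close>-chain with \<open>n+1\<close> entries gives \<open>n+1\<close> elements of \<open>Z\<close>, each differing from the
  next in a single entry, and so joined by alternating steps; permuting the two congruences gives a
  second path in \<open>Z\<close>, along whose diagonal one reads an \<open>E\<close>-chain with \<open>n\<close> entries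
  (\<open>power_incl_if_permutable\<close>). With \<open>E = SR\<close> this gives
  \<open>(S,R)\<^sub>2\<^sub>n\<^sub>-\<^sub>1 \<subseteq> (SR)\<^sup>n \<subseteq> (SR)\<^sup>n\<^sup>-\<^sup>1 \<subseteq> (R,S)\<^sub>2\<^sub>n\<^sub>-\<^sub>1\<close>.

  Conversely, the mixed condition for \<open>R = \<Delta>\<close> reads \<open>S\<^sup>n \<subseteq> S\<^sup>n\<^sup>-\<^sup>1\<close>. To get from there to
  \<open>n\<close>-permutability, a chain \<open>v\<^sub>0, \<dots>, v\<^sub>n\<close> of alternating steps \<open>T\<^sub>0, T\<^sub>1, \<dots>\<close> is turned into
  \<open>n+1\<close> elements of the object of chains for the relations \<open>T\<^sub>i T\<^sub>i\<^sub>+\<^sub>1\<close>, and the inclusion is applied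
  to a reflexive relation on that object which compares each entry of one chain with the
  following entry of another; again the diagonal of the shorter path is the chain that is wanted
  (\<open>preorders_permute_if_power_incl\<close>). This is the translation, into chains, of the derivation of
  the Hagemann-Mitschke terms for \<open>n\<close>-permutable varieties.
\<close>

section \<open>Arrows, pullbacks and coequalizers\<close>

context category
begin

lemma homD:
  assumes "f \<in> hom A B"
  shows "f \<in> Arr C" "Dom C f = A" "Cod C f = B" "A \<in> Obj C" "B \<in> Obj C"
  using assms Dom_Obj Cod_Obj unfolding hom_def by auto

lemma homI: "\<lbrakk>f \<in> Arr C; Dom C f = A; Cod C f = B\<rbrakk> \<Longrightarrow> f \<in> hom A B"
  unfolding hom_def by simp

lemma comp_hom: "\<lbrakk>f \<in> hom A B; g \<in> hom B D\<rbrakk> \<Longrightarrow> g \<cdot> f \<in> hom A D"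
  by (rule homI) (simp_all add: hom_def Comp_Arr Dom_Comp Cod_Comp)

lemma assoc: "\<lbrakk>f \<in> hom A B; g \<in> hom B D; h \<in> hom D F\<rbrakk> \<Longrightarrow> h \<cdot> g \<cdot> f = h \<cdot> (g \<cdot> f)"
  by (rule Comp_assoc[symmetric]) (auto dest: homD)

lemma ident_hom: "X \<in> Obj C \<Longrightarrow> Ident C X \<in> hom X X"
  by (simp add: homI Ident_Arr Dom_Ident Cod_Ident)

lemma comp_ident: "f \<in> hom A B \<Longrightarrow> f \<cdot> Ident C A = f"
  using Comp_Ident homD by fastforce

lemma ident_comp: "f \<in> hom A B \<Longrightarrow> Ident C B \<cdot> f = f"
  using Ident_Comp homD by fastforce

lemma monic_hom: "monic m \<Longrightarrow> m \<in> hom (Dom C m) (Cod C m)"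
  unfolding monic_def hom_def by simp

lemma monicD: "\<lbrakk>monic m; f \<in> hom A (Dom C m); g \<in> hom A (Dom C m); m \<cdot> f = m \<cdot> g\<rbrakk> \<Longrightarrow> f = g"
  unfolding monic_def by blast

lemma pullback_homs:
  assumes "is_pullback f g p q"
  shows "f \<in> hom (Dom C f) (Cod C f)" "g \<in> hom (Dom C g) (Cod C f)"
    "p \<in> hom (Dom C p) (Dom C f)" "q \<in> hom (Dom C p) (Dom C g)" "f \<cdot> p = g \<cdot> q"
  using assms unfolding is_pullback_def hom_def by auto

lemma pullback_lift:
  assumes "is_pullback f g p q" "h \<in> hom Z (Dom C f)" "k \<in> hom Z (Dom C g)" "f \<cdot> h = g \<cdot> k"
  obtains u where "u \<in> hom Z (Dom C p)" "p \<cdot> u = h" "q \<cdot> u = k"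
  using assms unfolding is_pullback_def by blast

lemma coequalizer_homs:
  assumes "is_coequalizer f g e"
  shows "f \<in> hom (Dom C f) (Cod C f)" "g \<in> hom (Dom C f) (Cod C f)"
    "e \<in> hom (Cod C f) (Cod C e)" "e \<cdot> f = e \<cdot> g"
  using assms unfolding is_coequalizer_def hom_def by auto

lemma coequalizer_lift:
  assumes "is_coequalizer f g e" "h \<in> hom (Cod C f) Z" "h \<cdot> f = h \<cdot> g"
  obtains u where "u \<in> hom (Cod C e) Z" "u \<cdot> e = h"
  using assms unfolding is_coequalizer_def by blast

lemma coequalizer_epi:
  assumes co: "is_coequalizer f g e" and x: "x \<in> hom (Cod C e) Z" and y: "y \<in> hom (Cod C e) Z"
    and eq: "x \<cdot> e = y \<cdot> e"
  shows "x = y"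
proof -
  note h = coequalizer_homs[OF co]
  have 1: "x \<cdot> e \<in> hom (Cod C f) Z" using comp_hom[OF h(3) x] .
  have 2: "(x \<cdot> e) \<cdot> f = (x \<cdot> e) \<cdot> g"
    using assoc[OF h(1) h(3) x] assoc[OF h(2) h(3) x] h(4) by simp
  show ?thesis using co x y eq 1 2 unfolding is_coequalizer_def by metis
qed

lemma regular_epi_hom: "regular_epi e \<Longrightarrow> e \<in> hom (Dom C e) (Cod C e)"
  unfolding regular_epi_def using coequalizer_homs(3) homD homI by metis

text \<open>This is what makes the choices of monomorphic parts in a composite relation a whole
  isomorphism class.\<close>

lemma regular_epi_iso_comp:
  assumes e: "regular_epi e" and v: "v \<in> hom (Cod C e) B" and w: "w \<in> hom B (Cod C e)"
    and wv: "w \<cdot> v = Ident C (Cod C e)" and vw: "v \<cdot> w = Ident C B"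
  shows "regular_epi (v \<cdot> e)"
proof -
  from e obtain f g where co: "is_coequalizer f g e" unfolding regular_epi_def by blast
  note h = coequalizer_homs[OF co]
  have ve: "v \<cdot> e \<in> hom (Cod C f) B" by (rule comp_hom[OF h(3) v])
  have "\<exists>!u. u \<in> hom B Z \<and> u \<cdot> (v \<cdot> e) = k"
    if k: "k \<in> hom (Cod C f) Z" "k \<cdot> f = k \<cdot> g" for k Z
  proof -
    obtain u where u: "u \<in> hom (Cod C e) Z" "u \<cdot> e = k" using coequalizer_lift[OF co k] .
    have "(u \<cdot> w) \<cdot> (v \<cdot> e) = ((u \<cdot> w) \<cdot> v) \<cdot> e"
      using assoc[OF h(3) v comp_hom[OF w u(1)]] by simp
    also have "\<dots> = k" using assoc[OF v w u(1)] wv comp_ident[OF u(1)] u(2) by simp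
    finally have ex: "(u \<cdot> w) \<cdot> (v \<cdot> e) = k" .
    have uniq: "u' = u \<cdot> w" if u': "u' \<in> hom B Z" "u' \<cdot> (v \<cdot> e) = k" for u'
    proof -
      have "(u' \<cdot> v) \<cdot> e = u \<cdot> e" using assoc[OF h(3) v u'(1)] u'(2) u(2) by simp
      then have "u' \<cdot> v = u" using coequalizer_epi[OF co comp_hom[OF v u'(1)] u(1)] by simp
      then show ?thesis using assoc[OF w v u'(1)] vw comp_ident[OF u'(1)] by simp
    qed
    show ?thesis using ex uniq comp_hom[OF w u(1)] by blast
  qed
  moreover have "(v \<cdot> e) \<cdot> f = (v \<cdot> e) \<cdot> g"
    using assoc[OF h(1) h(3) v] assoc[OF h(2) h(3) v] h(4) by simp
  ultimately have "is_coequalizer f g (v \<cdot> e)"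
    unfolding is_coequalizer_def using homD[OF ve] h ve homD(1)[OF h(1)] by simp
  then show ?thesis unfolding regular_epi_def by blast
qed

section \<open>Coverings and images\<close>

text \<open>Finite composites of regular epimorphisms. They serve as the coverings after which
  generalized elements may be chosen; closure under composition lets a second choice be made
  after a first one.\<close>

inductive cover :: "'m \<Rightarrow> bool" where
  cover_ident: "X \<in> Obj C \<Longrightarrow> cover (Ident C X)"
| cover_step: "\<lbrakk>cover c; regular_epi e; Cod C e = Dom C c\<rbrakk> \<Longrightarrow> cover (c \<cdot> e)"

lemma cover_hom: "cover c \<Longrightarrow> c \<in> hom (Dom C c) (Cod C c)"
proof (induction rule: cover.induct)
  case (cover_ident X)
  then show ?case using ident_hom homD by metis
next
  case (cover_step c e)
  have "c \<cdot> e \<in> hom (Dom C e) (Cod C c)"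
    using comp_hom regular_epi_hom[OF cover_step.hyps(2)] cover_step by metis
  then show ?case using homD by metis
qed

lemma cover_comp:
  assumes "cover d" "cover c" "Cod C d = Dom C c"
  shows "cover (c \<cdot> d)"
  using assms
proof (induction rule: cover.induct)
  case (cover_ident X)
  then show ?case using comp_ident[OF cover_hom[of c]] Cod_Ident by metis
next
  case (cover_step d e)
  have d: "d \<in> hom (Dom C d) (Dom C c)" using cover_hom[OF cover_step.hyps(1)]
    Cod_Comp cover_step regular_epi_hom[OF cover_step.hyps(2)] by (metis homD(1))
  have e: "e \<in> hom (Dom C e) (Dom C d)" using regular_epi_hom[OF cover_step.hyps(2)] cover_step by simp
  have c: "c \<in> hom (Dom C c) (Cod C c)" using cover_hom cover_step by blast
  have "cover ((c \<cdot> d) \<cdot> e)"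
    by (rule cover.cover_step)
      (use cover_step homD[OF d] homD[OF comp_hom[OF d c]] in auto)
  then show ?case using assoc[OF e d c] by simp
qed

text \<open>Coverings are orthogonal to monomorphisms: for a single coequalizer of \<open>f\<close> and \<open>g\<close>, the
  arrow \<open>k\<close> into the domain of \<open>m\<close> coequalizes \<open>f\<close> and \<open>g\<close> because \<open>m \<cdot> k\<close> does and \<open>m\<close> is
  monic, so that \<open>k\<close> descends. It follows that whether a pair of arrows belongs to a relation can be
  tested on a covering.\<close>

lemma cover_factor:
  assumes "cover c" "monic m" "t \<in> hom (Cod C c) (Cod C m)" "k \<in> hom (Dom C c) (Dom C m)"
    "m \<cdot> k = t \<cdot> c"
  shows "\<exists>u\<in>hom (Cod C c) (Dom C m). m \<cdot> u = t"
  using assms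
proof (induction arbitrary: k rule: cover.induct)
  case (cover_ident X)
  then show ?case using comp_ident Dom_Ident Cod_Ident by metis
next
  case (cover_step c e)
  note m = monic_hom[OF \<open>monic m\<close>]
  have c: "c \<in> hom (Dom C c) (Cod C c)" using cover_hom cover_step by blast
  have e: "e \<in> hom (Dom C e) (Dom C c)" using regular_epi_hom cover_step by metis
  note ce = homD[OF comp_hom[OF e c]]
  have k: "k \<in> hom (Dom C e) (Dom C m)" and t: "t \<in> hom (Cod C c) (Cod C m)"
    using cover_step ce by auto
  have mk: "m \<cdot> k = (t \<cdot> c) \<cdot> e" using cover_step assoc[OF e c t] by simp
  from cover_step obtain f g where co: "is_coequalizer f g e" unfolding regular_epi_def by blast
  note h = coequalizer_homs[OF co]
  have fe: "Cod C f = Dom C e" using homD(2)[OF h(3)] by simp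
  have f: "f \<in> hom (Dom C f) (Dom C e)" and g: "g \<in> hom (Dom C f) (Dom C e)"
    using h fe by auto
  have tc: "t \<cdot> c \<in> hom (Dom C c) (Cod C m)" using comp_hom[OF c t] .
  have "m \<cdot> (k \<cdot> f) = (m \<cdot> k) \<cdot> f" using assoc[OF f k m] by simp
  also have "\<dots> = (t \<cdot> c) \<cdot> (e \<cdot> g)" unfolding mk using assoc[OF f e tc] h(4) by simp
  also have "\<dots> = (m \<cdot> k) \<cdot> g" unfolding mk using assoc[OF g e tc] by simp
  also have "\<dots> = m \<cdot> (k \<cdot> g)" using assoc[OF g k m] by simp
  finally have "k \<cdot> f = k \<cdot> g"
    using monicD[OF \<open>monic m\<close> comp_hom[OF f k] comp_hom[OF g k]] by simp
  then obtain l where l: "l \<in> hom (Dom C c) (Dom C m)" "l \<cdot> e = k"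
    using coequalizer_lift[OF co, of k "Dom C m"] k fe homD(3)[OF e] by metis
  have "(m \<cdot> l) \<cdot> e = (t \<cdot> c) \<cdot> e" using assoc[OF e l(1) m] l mk by simp
  then have "m \<cdot> l = t \<cdot> c"
    using coequalizer_epi[OF co] comp_hom[OF l(1) m] tc homD(3)[OF e] by metis
  then show ?case using cover_step.IH[OF \<open>monic m\<close> t l(1)] ce by simp
qed

lemma cover_epi:
  assumes "cover c" "x \<in> hom (Cod C c) Z" "y \<in> hom (Cod C c) Z" "x \<cdot> c = y \<cdot> c"
  shows "x = y"
  using assms
proof (induction rule: cover.induct)
  case (cover_ident X)
  then show ?case using comp_ident Cod_Ident by metis
next
  case (cover_step c e)
  have c: "c \<in> hom (Dom C c) (Cod C c)" using cover_hom cover_step by blast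
  have e: "e \<in> hom (Dom C e) (Dom C c)" using regular_epi_hom cover_step by metis
  have x: "x \<in> hom (Cod C c) Z" and y: "y \<in> hom (Cod C c) Z"
    using cover_step homD[OF comp_hom[OF e c]] by auto
  from cover_step obtain f g where co: "is_coequalizer f g e" unfolding regular_epi_def by blast
  have "(x \<cdot> c) \<cdot> e = (y \<cdot> c) \<cdot> e"
    using cover_step assoc[OF e c x] assoc[OF e c y] by simp
  then have "x \<cdot> c = y \<cdot> c"
    using coequalizer_epi[OF co] comp_hom[OF c x] comp_hom[OF c y] homD(3)[OF e] by metis
  then show ?case using cover_step.IH x y by blast
qed

end

context regular_category
begin

text \<open>A commuting square is enough for what follows: an element that is an image under a covering
  can be lifted after a covering of its own domain.\<close>

lemma cover_pullback:
  assumes "cover c" "a \<in> hom W (Cod C c)"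
  shows "\<exists>c' a'. cover c' \<and> Cod C c' = W \<and> a' \<in> hom (Dom C c') (Dom C c) \<and> c \<cdot> a' = a \<cdot> c'"
  using assms
proof (induction rule: cover.induct)
  case (cover_ident X)
  then have a: "a \<in> hom W X" using Cod_Ident by simp
  then have "cover (Ident C W)" using cover.cover_ident homD(4) by blast
  then show ?case using comp_ident[OF a] ident_comp[OF a] a cover_ident homD(4)[OF a]
      Dom_Ident Cod_Ident by metis
next
  case (cover_step c e)
  have c: "c \<in> hom (Dom C c) (Cod C c)" using cover_hom cover_step by blast
  have e: "e \<in> hom (Dom C e) (Dom C c)" using regular_epi_hom cover_step by metis
  note ce = homD[OF comp_hom[OF e c]]
  have a: "a \<in> hom W (Cod C c)" using cover_step ce by simp
  obtain c1 a1 where 1: "cover c1" "Cod C c1 = W" "a1 \<in> hom (Dom C c1) (Dom C c)"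
    "c \<cdot> a1 = a \<cdot> c1" using cover_step.IH[OF a] by blast
  have c1: "c1 \<in> hom (Dom C c1) W" using cover_hom[OF 1(1)] 1(2) by simp
  obtain p q where pb: "is_pullback a1 e p q"
    using pullback_exists homD[OF 1(3)] homD[OF e] by metis
  have p: "p \<in> hom (Dom C p) (Dom C c1)" and q: "q \<in> hom (Dom C p) (Dom C e)"
    and eq: "a1 \<cdot> p = e \<cdot> q"
    using pullback_homs[OF pb] homD[OF 1(3)] by auto
  have "cover (c1 \<cdot> p)"
    using cover.cover_step[OF 1(1) regular_epi_pullback[OF pb]] cover_step homD(3)[OF p] by blast
  moreover have "(c \<cdot> e) \<cdot> q = a \<cdot> (c1 \<cdot> p)"
    using assoc[OF q e c] eq assoc[OF p 1(3) c] 1(4) assoc[OF p c1 a] by metis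
  moreover have "c1 \<cdot> p \<in> hom (Dom C p) W" by (rule comp_hom[OF p c1])
  ultimately show ?case using q ce homD by metis
qed

lemma regular_epi_cover:
  assumes "regular_epi e"
  shows "cover e"
proof -
  have e: "e \<in> hom (Dom C e) (Cod C e)" using regular_epi_hom assms by blast
  have "cover (Ident C (Cod C e) \<cdot> e)"
    by (rule cover.cover_step[OF cover_ident]) (use assms homD[OF e] Dom_Ident in auto)
  then show ?thesis using ident_comp[OF e] by simp
qed

text \<open>The epimorphic part is the coequalizer \<open>e\<close> of the kernel pair of \<open>f\<close>. The remaining arrow \<open>m\<close>
  is monic since two elements of the image with the same value under \<open>m\<close> lift, after a covering, to
  two elements of \<open>A\<close> with the same value under \<open>f\<close>; these form an element of the kernel pair, and
  \<open>e\<close> identifies them.\<close>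

lemma image_factorization:
  assumes f: "f \<in> hom A B"
  obtains m e I where "monic m" "regular_epi e" "e \<in> hom A I" "m \<in> hom I B" "m \<cdot> e = f"
proof -
  obtain p q where pb: "is_pullback f f p q" using pullback_exists homD[OF f] by metis
  obtain e where co: "is_coequalizer p q e" using kernel_pair_coequalizer[OF pb] by blast
  have re: "regular_epi e" using co unfolding regular_epi_def by blast
  note h = coequalizer_homs[OF co]
  note ph = pullback_homs[OF pb]
  have pA: "Cod C p = A" using homD(3)[OF ph(3)] homD[OF f] by simp
  have e: "e \<in> hom A (Cod C e)" using h(3) pA by simp
  obtain m where m: "m \<in> hom (Cod C e) B" "m \<cdot> e = f"
    using coequalizer_lift[OF co, of f B] f ph(5) pA by metis
  have "x = y" if x: "x \<in> hom Z (Cod C e)" and y: "y \<in> hom Z (Cod C e)" and eq: "m \<cdot> x = m \<cdot> y"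
    for Z x y
  proof -
    obtain c x' where 1: "cover c" "Cod C c = Z" "x' \<in> hom (Dom C c) A" "e \<cdot> x' = x \<cdot> c"
      using cover_pullback[OF regular_epi_cover[OF re] x] homD[OF e] by metis
    have c: "c \<in> hom (Dom C c) Z" using cover_hom 1 by metis
    obtain d y' where 2: "cover d" "Cod C d = Dom C c" "y' \<in> hom (Dom C d) A"
      "e \<cdot> y' = (y \<cdot> c) \<cdot> d"
      using cover_pullback[OF regular_epi_cover[OF re] comp_hom[OF c y]] homD[OF e] by metis
    have d: "d \<in> hom (Dom C d) (Dom C c)" using cover_hom 2 by metis
    have x'd: "x' \<cdot> d \<in> hom (Dom C d) A" using comp_hom[OF d 1(3)] .
    have ex': "e \<cdot> (x' \<cdot> d) = (x \<cdot> c) \<cdot> d" using assoc[OF d 1(3) e] 1(4) by simp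
    have "f \<cdot> (x' \<cdot> d) = m \<cdot> ((x \<cdot> c) \<cdot> d)" using assoc[OF x'd e m(1)] m(2) ex' by simp
    also have "\<dots> = m \<cdot> ((y \<cdot> c) \<cdot> d)"
      using assoc[OF d comp_hom[OF c x] m(1)] assoc[OF d comp_hom[OF c y] m(1)]
        assoc[OF c x m(1)] assoc[OF c y m(1)] eq by simp
    also have "\<dots> = f \<cdot> y'" using assoc[OF 2(3) e m(1)] m(2) 2(4) by simp
    finally obtain u where u: "u \<in> hom (Dom C d) (Dom C p)" "p \<cdot> u = x' \<cdot> d" "q \<cdot> u = y'"
      using pullback_lift[OF pb, of "x' \<cdot> d" "Dom C d" y'] x'd 2(3) homD[OF f] by metis
    have p: "p \<in> hom (Dom C p) A" and q: "q \<in> hom (Dom C p) A" using ph homD[OF f] by auto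
    have "e \<cdot> (x' \<cdot> d) = e \<cdot> y'"
      using assoc[OF u(1) p e] assoc[OF u(1) q e] h(4) u by simp
    then have "(x \<cdot> c) \<cdot> d = (y \<cdot> c) \<cdot> d" using ex' 2(4) by simp
    then have "x \<cdot> c = y \<cdot> c" using cover_epi[OF 2(1)] comp_hom[OF c x] comp_hom[OF c y] 2(2) by metis
    then show ?thesis using cover_epi[OF 1(1)] x y 1(2) by metis
  qed
  then have "monic m" unfolding monic_def using homD[OF m(1)] by simp
  then show ?thesis using that re e m by blast
qed

section \<open>Binary products\<close>

lemma product_exists:
  assumes "A \<in> Obj C" "B \<in> Obj C"
  shows "\<exists>P p q. is_product A B P p q"
proof -
  obtain T where T: "is_terminal T" using terminal_exists by blast
  then obtain f g where fg: "f \<in> hom A T" "g \<in> hom B T" using assms unfolding is_terminal_def by blast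
  have uniq: "h = k" if "h \<in> hom Z T" "k \<in> hom Z T" for Z h k
    using T that homD(4) unfolding is_terminal_def by blast
  obtain p q where pb: "is_pullback f g p q" using pullback_exists homD[OF fg(1)] homD[OF fg(2)] by metis
  have "is_product A B (Dom C p) p q"
    unfolding is_product_def
  proof (intro conjI allI ballI)
    show "p \<in> hom (Dom C p) A" "q \<in> hom (Dom C p) B"
      using pullback_homs[OF pb] homD[OF fg(1)] homD[OF fg(2)] by auto
    fix Z h k assume hk: "h \<in> hom Z A" "k \<in> hom Z B"
    have "f \<cdot> h = g \<cdot> k" using uniq comp_hom hk fg by blast
    then show "\<exists>!u. u \<in> hom Z (Dom C p) \<and> p \<cdot> u = h \<and> q \<cdot> u = k"
      using pb hk homD[OF fg(1)] homD[OF fg(2)] unfolding is_pullback_def by auto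
  qed
  then show ?thesis by blast
qed

lemma prd_product:
  assumes "A \<in> Obj C" "B \<in> Obj C"
  shows "is_product A B (prd A B) (pr1 A B) (pr2 A B)"
proof -
  have "case prod_cone A B of (P, p, q) \<Rightarrow> is_product A B P p q"
    unfolding prod_cone_def using product_exists[OF assms] by (rule_tac someI_ex) auto
  then show ?thesis unfolding prd_def pr1_def pr2_def by (auto split: prod.splits)
qed

lemma pr_hom:
  assumes "X \<in> Obj C"
  shows "pr1 X X \<in> hom (prd X X) X" "pr2 X X \<in> hom (prd X X) X"
  using prd_product[OF assms assms] unfolding is_product_def by auto

lemma pair_eqI:
  assumes X: "X \<in> Obj C" and u: "u \<in> hom U (prd X X)" and v: "v \<in> hom U (prd X X)"
    and "pr1 X X \<cdot> u = pr1 X X \<cdot> v" "pr2 X X \<cdot> u = pr2 X X \<cdot> v"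
  shows "u = v"
  using prd_product[OF X X] assms comp_hom[OF v pr_hom(1)[OF X]] comp_hom[OF v pr_hom(2)[OF X]]
  unfolding is_product_def by metis

lemma tuple_props:
  assumes a: "a \<in> hom U X" and b: "b \<in> hom U X"
  shows "tuple X a b \<in> hom U (prd X X)" "pr1 X X \<cdot> tuple X a b = a" "pr2 X X \<cdot> tuple X a b = b"
proof -
  have X: "X \<in> Obj C" using homD[OF a] by blast
  have ex1: "\<exists>!u. u \<in> hom (Dom C a) (prd X X) \<and> pr1 X X \<cdot> u = a \<and> pr2 X X \<cdot> u = b"
    using prd_product[OF X X] a b homD[OF a] unfolding is_product_def by blast
  show "tuple X a b \<in> hom U (prd X X)" "pr1 X X \<cdot> tuple X a b = a" "pr2 X X \<cdot> tuple X a b = b"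
    using theI'[OF ex1] homD[OF a] unfolding tuple_def by auto
qed

end

context category
begin

section \<open>Subobjects and relations\<close>

lemma monic_comp:
  assumes m: "monic m" and k: "monic k" and "Cod C k = Dom C m"
  shows "monic (m \<cdot> k)"
proof -
  have mh: "m \<in> hom (Dom C m) (Cod C m)" using monic_hom[OF m] .
  have kh: "k \<in> hom (Dom C k) (Dom C m)" using monic_hom[OF k] assms(3) by simp
  have "f = g" if f: "f \<in> hom A (Dom C k)" and g: "g \<in> hom A (Dom C k)"
    and eq: "(m \<cdot> k) \<cdot> f = (m \<cdot> k) \<cdot> g" for A f g
  proof -
    have "k \<cdot> f = k \<cdot> g"
      by (rule monicD[OF m comp_hom[OF f kh] comp_hom[OF g kh]])
        (use eq assoc[OF f kh mh] assoc[OF g kh mh] in simp)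
    then show ?thesis using monicD[OF k f g] by simp
  qed
  then show ?thesis unfolding monic_def using homD[OF comp_hom[OF kh mh]] by simp
qed

lemma pullback_monic:
  assumes pb: "is_pullback f g p q" and g: "monic g"
  shows "monic p"
proof -
  note h = pullback_homs[OF pb]
  have "x = y" if x: "x \<in> hom A (Dom C p)" and y: "y \<in> hom A (Dom C p)" and eq: "p \<cdot> x = p \<cdot> y"
    for A x y
  proof -
    have fq: "f \<cdot> (p \<cdot> z) = g \<cdot> (q \<cdot> z)" if z: "z \<in> hom A (Dom C p)" for z
      using assoc[OF z h(3,1)] assoc[OF z h(4,2)] h(5) by simp
    have "q \<cdot> x = q \<cdot> y"
      by (rule monicD[OF g comp_hom[OF x h(4)] comp_hom[OF y h(4)]])
        (use fq[OF x] fq[OF y] eq in simp)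
    moreover have "\<exists>!u. u \<in> hom A (Dom C p) \<and> p \<cdot> u = p \<cdot> x \<and> q \<cdot> u = q \<cdot> x"
      using pb comp_hom[OF x h(3)] comp_hom[OF x h(4)] fq[OF x] unfolding is_pullback_def by blast
    ultimately show ?thesis using x y eq by metis
  qed
  then show ?thesis unfolding monic_def using homD[OF h(3)] by simp
qed

lemma monic_ident: "X \<in> Obj C \<Longrightarrow> monic (Ident C X)"
  unfolding monic_def using ident_comp Ident_Arr Dom_Ident by metis

lemma subobj_self: "monic m \<Longrightarrow> m \<in> subobj m"
proof -
  assume m: "monic m"
  let ?i = "Ident C (Dom C m)"
  have D: "Dom C m \<in> Obj C" using homD(4)[OF monic_hom[OF m]] .
  have i: "?i \<in> hom (Dom C m) (Dom C m)" using ident_hom[OF D] .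
  have "iso ?i" unfolding iso_def using i homD[OF i] comp_ident[OF i] by metis
  then show ?thesis unfolding subobj_def using m i comp_ident[OF monic_hom[OF m]] by auto
qed

lemma subobj_memI:
  assumes x: "monic x" and m: "monic m"
    and u: "u \<in> hom (Dom C x) (Dom C m)" "x = m \<cdot> u"
    and v: "v \<in> hom (Dom C m) (Dom C x)" "m = x \<cdot> v"
  shows "x \<in> subobj m"
proof -
  have CM: "Cod C x = Cod C m" using homD[OF comp_hom[OF u(1) monic_hom[OF m]]] u(2) by simp
  have xh: "x \<in> hom (Dom C x) (Cod C m)" and mh: "m \<in> hom (Dom C m) (Cod C m)"
    using monic_hom x m CM by metis+
  have "m \<cdot> (u \<cdot> v) = m \<cdot> Ident C (Dom C m)"
    using assoc[OF v(1) u(1) mh] u(2) v(2) comp_ident[OF mh] by metis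
  then have "u \<cdot> v = Ident C (Dom C m)"
    using monicD[OF m comp_hom[OF v(1) u(1)] ident_hom[OF homD(4)[OF mh]]] by blast
  moreover have "x \<cdot> (v \<cdot> u) = x \<cdot> Ident C (Dom C x)"
    using assoc[OF u(1) v(1) xh] u(2) v(2) comp_ident[OF xh] by metis
  then have "v \<cdot> u = Ident C (Dom C x)"
    using monicD[OF x comp_hom[OF u(1) v(1)] ident_hom[OF homD(4)[OF xh]]] by blast
  ultimately have "iso u" unfolding iso_def using homD[OF u(1)] v(1) by auto
  then show ?thesis unfolding subobj_def using x u by blast
qed

lemma subobj_factor:
  assumes "r \<in> subobj m" "s \<in> subobj m" "monic m"
  shows "\<exists>u\<in>hom (Dom C r) (Dom C s). r = s \<cdot> u"
proof -
  obtain u where u: "u \<in> hom (Dom C r) (Dom C m)" "r = m \<cdot> u"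
    using assms(1) unfolding subobj_def by blast
  obtain v where v: "v \<in> hom (Dom C s) (Dom C m)" "iso v" "s = m \<cdot> v"
    using assms(2) unfolding subobj_def by blast
  obtain w where w: "w \<in> hom (Dom C m) (Dom C s)" "v \<cdot> w = Ident C (Dom C m)"
    using v(2) homD[OF v(1)] unfolding iso_def by metis
  note m = monic_hom[OF assms(3)]
  have "s \<cdot> (w \<cdot> u) = (s \<cdot> w) \<cdot> u" using assoc[OF u(1) w(1)] v(3) comp_hom[OF v(1) m] by simp
  also have "\<dots> = r" using v(3) assoc[OF w(1) v(1) m] w(2) comp_ident[OF m] u(2) by simp
  finally show ?thesis using comp_hom[OF u(1) w(1)] by auto
qed

lemma rels_monic: "\<lbrakk>R \<in> rels X; r \<in> R\<rbrakk> \<Longrightarrow> monic r \<and> Cod C r = prd X X"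
proof -
  assume "R \<in> rels X" "r \<in> R"
  then obtain m where m: "monic m" "Cod C m = prd X X" "r \<in> subobj m" unfolding rels_def by blast
  then obtain u where u: "u \<in> hom (Dom C r) (Dom C m)" "r = m \<cdot> u" "monic r"
    unfolding subobj_def by blast
  then show ?thesis using homD(3)[OF comp_hom[OF u(1) monic_hom[OF m(1)]]] m(2) by simp
qed

lemma rels_hom: "\<lbrakk>R \<in> rels X; r \<in> R\<rbrakk> \<Longrightarrow> r \<in> hom (Dom C r) (prd X X)"
  using rels_monic monic_hom by metis

lemma rels_factor:
  assumes "R \<in> rels X" "r \<in> R" "s \<in> R"
  shows "\<exists>u\<in>hom (Dom C r) (Dom C s). r = s \<cdot> u"
  using assms subobj_factor unfolding rels_def by blast

lemma rels_nonempty: "R \<in> rels X \<Longrightarrow> \<exists>r. r \<in> R"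
  unfolding rels_def using subobj_self by blast

lemma rels_memI:
  assumes R: "R \<in> rels X" and r: "r \<in> R" and x: "monic x"
    and u: "u \<in> hom (Dom C x) (Dom C r)" "x = r \<cdot> u"
    and v: "v \<in> hom (Dom C r) (Dom C x)" "r = x \<cdot> v"
  shows "x \<in> R"
proof -
  obtain m where m: "monic m" "Cod C m = prd X X" "R = subobj m" using R unfolding rels_def by blast
  note rh = rels_hom[OF R r]
  have mh: "m \<in> hom (Dom C m) (prd X X)" using monic_hom m by metis
  have xh: "x \<in> hom (Dom C x) (prd X X)" using comp_hom[OF u(1) rh] u(2) by simp
  obtain w where w: "w \<in> hom (Dom C r) (Dom C m)" "r = m \<cdot> w"
    using subobj_factor[of r m m] r m subobj_self by blast
  obtain z where z: "z \<in> hom (Dom C m) (Dom C r)" "m = r \<cdot> z"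
    using subobj_factor[of m m r] r m subobj_self by blast
  have "x = m \<cdot> (w \<cdot> u)" using assoc[OF u(1) w(1) mh] w(2) u(2) by simp
  moreover have "m = x \<cdot> (v \<cdot> z)" using assoc[OF z(1) v(1) xh] v(2) z(2) by simp
  ultimately show ?thesis
    using subobj_memI[OF x m(1) comp_hom[OF u(1) w(1)] _ comp_hom[OF z(1) v(1)]] m(3) by simp
qed

lemma subobj_in_rels: "m \<in> hom A (prd X X) \<Longrightarrow> monic m \<Longrightarrow> subobj m \<in> rels X"
  unfolding rels_def using homD(3) by auto

section \<open>Generalized elements of relations\<close>

text \<open>The pair \<open>(a, b)\<close> of elements of \<open>X\<close> at stage \<open>U = Dom C a\<close> belongs to \<open>R\<close>. Any representative
  of \<open>R\<close> may be used, by \<open>holds_iff\<close>.\<close>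

definition holds :: "'o \<Rightarrow> 'm set \<Rightarrow> 'm \<Rightarrow> 'm \<Rightarrow> bool" where
  "holds X R a b \<longleftrightarrow>
     (\<exists>r\<in>R. \<exists>u\<in>hom (Dom C a) (Dom C r). pr1 X X \<cdot> (r \<cdot> u) = a \<and> pr2 X X \<cdot> (r \<cdot> u) = b)"

lemma holds_iff:
  assumes R: "R \<in> rels X" and r: "r \<in> R" and a: "a \<in> hom U X"
  shows "holds X R a b \<longleftrightarrow>
    (\<exists>u\<in>hom U (Dom C r). pr1 X X \<cdot> (r \<cdot> u) = a \<and> pr2 X X \<cdot> (r \<cdot> u) = b)"
proof
  assume "holds X R a b"
  then obtain s u where s: "s \<in> R" and u: "u \<in> hom U (Dom C s)"
    "pr1 X X \<cdot> (s \<cdot> u) = a" "pr2 X X \<cdot> (s \<cdot> u) = b"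
    unfolding holds_def using homD[OF a] by auto
  obtain w where w: "w \<in> hom (Dom C s) (Dom C r)" "s = r \<cdot> w" using rels_factor[OF R s r] by blast
  have "s \<cdot> u = r \<cdot> (w \<cdot> u)" using assoc[OF u(1) w(1) rels_hom[OF R r]] w(2) by simp
  then show "\<exists>u\<in>hom U (Dom C r). pr1 X X \<cdot> (r \<cdot> u) = a \<and> pr2 X X \<cdot> (r \<cdot> u) = b"
    using u comp_hom[OF u(1) w(1)] by auto
next
  assume "\<exists>u\<in>hom U (Dom C r). pr1 X X \<cdot> (r \<cdot> u) = a \<and> pr2 X X \<cdot> (r \<cdot> u) = b"
  then show "holds X R a b" unfolding holds_def using r homD[OF a] by auto
qed

end

context regular_category
begin

lemma holds_self:
  assumes X: "X \<in> Obj C" and R: "R \<in> rels X" and r: "r \<in> R"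
  shows "holds X R (pr1 X X \<cdot> r) (pr2 X X \<cdot> r)"
proof -
  have rh: "r \<in> hom (Dom C r) (prd X X)" using rels_hom[OF R r] .
  show ?thesis
    using holds_iff[OF R r comp_hom[OF rh pr_hom(1)[OF X]]] ident_hom[OF homD(4)[OF rh]]
      comp_ident[OF rh] by metis
qed

lemma holds_precomp:
  assumes R: "R \<in> rels X" and a: "a \<in> hom U X" and b: "b \<in> hom U X" and h: "holds X R a b"
    and c: "c \<in> hom V U"
  shows "holds X R (a \<cdot> c) (b \<cdot> c)"
proof -
  have X: "X \<in> Obj C" using homD[OF a] by blast
  obtain r where r: "r \<in> R" using rels_nonempty[OF R] by blast
  note rh = rels_hom[OF R r]
  obtain u where u: "u \<in> hom U (Dom C r)" "pr1 X X \<cdot> (r \<cdot> u) = a" "pr2 X X \<cdot> (r \<cdot> u) = b"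
    using h holds_iff[OF R r a] by blast
  have "pr1 X X \<cdot> (r \<cdot> (u \<cdot> c)) = a \<cdot> c" "pr2 X X \<cdot> (r \<cdot> (u \<cdot> c)) = b \<cdot> c"
    using assoc[OF c u(1) rh] assoc[OF c comp_hom[OF u(1) rh]] pr_hom[OF X] u by metis+
  then show ?thesis using holds_iff[OF R r comp_hom[OF c a]] comp_hom[OF c u(1)] by blast
qed

lemma holds_local:
  assumes R: "R \<in> rels X" and a: "a \<in> hom U X" and b: "b \<in> hom U X"
    and c: "cover c" "Cod C c = U" and h: "holds X R (a \<cdot> c) (b \<cdot> c)"
  shows "holds X R a b"
proof -
  have X: "X \<in> Obj C" using homD[OF a] by blast
  have ch: "c \<in> hom (Dom C c) U" using cover_hom c by metis
  obtain r where r: "r \<in> R" using rels_nonempty[OF R] by blast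
  note rh = rels_hom[OF R r]
  obtain k where k: "k \<in> hom (Dom C c) (Dom C r)" "pr1 X X \<cdot> (r \<cdot> k) = a \<cdot> c"
    "pr2 X X \<cdot> (r \<cdot> k) = b \<cdot> c"
    using h holds_iff[OF R r comp_hom[OF ch a]] by blast
  note t = tuple_props[OF a b]
  have "r \<cdot> k = tuple X a b \<cdot> c"
    by (rule pair_eqI[OF X comp_hom[OF k(1) rh] comp_hom[OF ch t(1)]])
      (use k assoc[OF ch t(1) pr_hom(1)[OF X]] assoc[OF ch t(1) pr_hom(2)[OF X]] t in auto)
  then obtain u where u: "u \<in> hom U (Dom C r)" "r \<cdot> u = tuple X a b"
    using cover_factor[OF c(1), of r "tuple X a b" k] rels_monic[OF R r] t(1) k(1) c(2) by auto
  then show ?thesis using holds_iff[OF R r a] t by metis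
qed

text \<open>The Yoneda lemma for relations: the inclusion is detected by the generic element of \<open>R\<close>,
  namely the pair of legs of a representative.\<close>

lemma incl_iff:
  assumes X: "X \<in> Obj C" and R: "R \<in> rels X" and S: "S \<in> rels X"
  shows "incl R S \<longleftrightarrow>
    (\<forall>U. \<forall>a\<in>hom U X. \<forall>b\<in>hom U X. holds X R a b \<longrightarrow> holds X S a b)"
proof
  assume "incl R S"
  then obtain r s w where r: "r \<in> R" and s: "s \<in> S" and w: "w \<in> hom (Dom C r) (Dom C s)" "r = s \<cdot> w"
    unfolding incl_def factors_through_def by blast
  show "\<forall>U. \<forall>a\<in>hom U X. \<forall>b\<in>hom U X. holds X R a b \<longrightarrow> holds X S a b"
  proof (intro allI ballI impI)
    fix U a b assume a: "a \<in> hom U X" and "holds X R a b"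
    then obtain u where u: "u \<in> hom U (Dom C r)" "pr1 X X \<cdot> (r \<cdot> u) = a" "pr2 X X \<cdot> (r \<cdot> u) = b"
      using holds_iff[OF R r a] by blast
    have "r \<cdot> u = s \<cdot> (w \<cdot> u)" using assoc[OF u(1) w(1) rels_hom[OF S s]] w(2) by simp
    then show "holds X S a b" using holds_iff[OF S s a] u comp_hom[OF u(1) w(1)] by auto
  qed
next
  assume H: "\<forall>U. \<forall>a\<in>hom U X. \<forall>b\<in>hom U X. holds X R a b \<longrightarrow> holds X S a b"
  obtain r s where r: "r \<in> R" and s: "s \<in> S" using rels_nonempty R S by blast
  note rh = rels_hom[OF R r] and sh = rels_hom[OF S s]
  have 1: "pr1 X X \<cdot> r \<in> hom (Dom C r) X" "pr2 X X \<cdot> r \<in> hom (Dom C r) X"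
    using comp_hom[OF rh] pr_hom[OF X] by auto
  have "holds X S (pr1 X X \<cdot> r) (pr2 X X \<cdot> r)" using H 1 holds_self[OF X R r] by blast
  then obtain u where u: "u \<in> hom (Dom C r) (Dom C s)" "pr1 X X \<cdot> (s \<cdot> u) = pr1 X X \<cdot> r"
    "pr2 X X \<cdot> (s \<cdot> u) = pr2 X X \<cdot> r"
    using holds_iff[OF S s 1(1)] by blast
  have "s \<cdot> u = r" using pair_eqI[OF X comp_hom[OF u(1) sh] rh u(2,3)] .
  then show "incl R S" unfolding incl_def factors_through_def using r s u(1) by blast
qed

lemma incl_rep:
  assumes R: "R \<in> rels X" and S: "S \<in> rels X" and i: "incl R S" and r: "r \<in> R" and s: "s \<in> S"
  shows "\<exists>u\<in>hom (Dom C r) (Dom C s). r = s \<cdot> u"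
proof -
  obtain r' s' w where w: "r' \<in> R" "s' \<in> S" "w \<in> hom (Dom C r') (Dom C s')" "r' = s' \<cdot> w"
    using i unfolding incl_def factors_through_def by blast
  obtain x where x: "x \<in> hom (Dom C r) (Dom C r')" "r = r' \<cdot> x" using rels_factor[OF R r w(1)] by blast
  obtain y where y: "y \<in> hom (Dom C s') (Dom C s)" "s' = s \<cdot> y" using rels_factor[OF S w(2) s] by blast
  note sh = rels_hom[OF S s] and sh' = rels_hom[OF S w(2)]
  have "r = s' \<cdot> (w \<cdot> x)" using assoc[OF x(1) w(3) sh'] w(4) x(2) by simp
  also have "\<dots> = s \<cdot> (y \<cdot> (w \<cdot> x))" using assoc[OF comp_hom[OF x(1) w(3)] y(1) sh] y(2) by simp
  finally show ?thesis using comp_hom[OF comp_hom[OF x(1) w(3)] y(1)] by blast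
qed

lemma incl_antisym:
  assumes "R \<in> rels X" "S \<in> rels X" "incl R S" "incl S R"
  shows "R = S"
proof -
  have "R \<subseteq> S" if R: "R \<in> rels X" and S: "S \<in> rels X" and 1: "incl R S" and 2: "incl S R" for R S
  proof
    fix r assume r: "r \<in> R"
    obtain s where s: "s \<in> S" using rels_nonempty[OF S] by blast
    show "r \<in> S"
      using incl_rep[OF R S 1 r s] incl_rep[OF S R 2 s r] rels_memI[OF S s] rels_monic[OF R r] by blast
  qed
  then show ?thesis using assms by blast
qed

lemma diag_rel:
  assumes X: "X \<in> Obj C"
  shows "diag X \<in> rels X"
    and "a \<in> hom U X \<Longrightarrow> b \<in> hom U X \<Longrightarrow> holds X (diag X) a b \<longleftrightarrow> a = b"
proof -
  let ?d = "tuple X (Ident C X) (Ident C X)"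
  note i = ident_hom[OF X]
  note t = tuple_props[OF i i]
  note p = pr_hom[OF X]
  have eq: "pr1 X X \<cdot> (?d \<cdot> u) = u" "pr2 X X \<cdot> (?d \<cdot> u) = u" if u: "u \<in> hom A X" for u A
    using assoc[OF u t(1)] p t(2,3) ident_comp[OF u] by metis+
  have m: "monic ?d" unfolding monic_def using homD[OF t(1)] eq by metis
  show R: "diag X \<in> rels X" unfolding diag_def using subobj_in_rels[OF t(1) m] .
  show "holds X (diag X) a b \<longleftrightarrow> a = b" if a: "a \<in> hom U X" and b: "b \<in> hom U X"
  proof -
    have "?d \<in> diag X" unfolding diag_def using subobj_self[OF m] .
    from holds_iff[OF R this a] show ?thesis using a eq homD[OF t(1)] by metis
  qed
qed

lemma holds_refl:
  assumes R: "reflexive_rel X R" and a: "a \<in> hom U X"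
  shows "holds X R a a"
  using assms incl_iff[OF _ diag_rel(1)] diag_rel(2) homD[OF a] unfolding reflexive_rel_def by metis

lemma reflexive_relI:
  assumes X: "X \<in> Obj C" and R: "R \<in> rels X" and "\<And>U a. a \<in> hom U X \<Longrightarrow> holds X R a a"
  shows "reflexive_rel X R"
  unfolding reflexive_rel_def
  using R incl_iff[OF X diag_rel(1)[OF X] R] diag_rel(2)[OF X] assms(3) by blast

lemma symmetric_relI:
  assumes X: "X \<in> Obj C" and R: "R \<in> rels X"
    and sym: "\<And>U a b. a \<in> hom U X \<Longrightarrow> b \<in> hom U X \<Longrightarrow> holds X R a b \<Longrightarrow> holds X R b a"
  shows "symmetric_rel X R"
proof -
  obtain r where r: "r \<in> R" using rels_nonempty[OF R] by blast
  note rh = rels_hom[OF R r] and p = pr_hom[OF X]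
  let ?a = "pr1 X X \<cdot> r" and ?b = "pr2 X X \<cdot> r"
  have ab: "?a \<in> hom (Dom C r) X" "?b \<in> hom (Dom C r) X" using comp_hom[OF rh] p by auto
  note t = tuple_props[OF ab(2,1)]
  obtain u where u: "u \<in> hom (Dom C r) (Dom C r)" "pr1 X X \<cdot> (r \<cdot> u) = ?b" "pr2 X X \<cdot> (r \<cdot> u) = ?a"
    using sym[OF ab holds_self[OF X R r]] holds_iff[OF R r ab(2)] by blast
  have "tuple X ?b ?a = r \<cdot> u"
    by (rule pair_eqI[OF X t(1) comp_hom[OF u(1) rh]]) (use t u in auto)
  then have "factors_through (tuple X ?b ?a) r" unfolding factors_through_def using u(1) homD[OF t(1)] by auto
  then show ?thesis unfolding symmetric_rel_def incl_def opp_def using R r by blast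
qed

text \<open>The elements of one representative \<open>m\<close> of a composite relation. An element of \<open>m\<close> lifts along
  the covering \<open>e\<close> to the pullback, whose elements are pairs with a common middle entry \<open>y\<close>;
  conversely such a pair gives an element of \<open>m\<close> on a covering, which descends as \<open>m\<close> is monic.
  The right hand side does not mention \<open>m\<close>, so all representatives have the same elements.\<close>

lemma holds_pullback_iff:
  assumes X: "X \<in> Obj C" and R: "R \<in> rels X" and S: "S \<in> rels X"
    and r: "r \<in> R" and s: "s \<in> S"
    and pb: "is_pullback (pr2 X X \<cdot> r) (pr1 X X \<cdot> s) a b"
    and e: "regular_epi e" "Cod C e = Dom C m" and m: "monic m"
    and me: "m \<cdot> e = tuple X (pr1 X X \<cdot> r \<cdot> a) (pr2 X X \<cdot> s \<cdot> b)"
  shows "m \<in> hom (Dom C m) (prd X X)"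
    and "x \<in> hom U X \<Longrightarrow> z \<in> hom U X \<Longrightarrow>
      (\<exists>u\<in>hom U (Dom C m). pr1 X X \<cdot> (m \<cdot> u) = x \<and> pr2 X X \<cdot> (m \<cdot> u) = z) \<longleftrightarrow>
      (\<exists>c y. cover c \<and> Cod C c = U \<and> y \<in> hom (Dom C c) X \<and>
         holds X R (x \<cdot> c) y \<and> holds X S y (z \<cdot> c))"
proof -
  note rh = rels_hom[OF R r] and sh = rels_hom[OF S s] and p = pr_hom[OF X]
  note h = pullback_homs[OF pb]
  have a: "a \<in> hom (Dom C a) (Dom C r)" and b: "b \<in> hom (Dom C a) (Dom C s)"
    using h(3,4) homD[OF comp_hom[OF rh p(2)]] homD[OF comp_hom[OF sh p(1)]] by auto
  have r1: "pr1 X X \<cdot> r \<in> hom (Dom C r) X" and r2: "pr2 X X \<cdot> r \<in> hom (Dom C r) X"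
    and s1: "pr1 X X \<cdot> s \<in> hom (Dom C s) X" and s2: "pr2 X X \<cdot> s \<in> hom (Dom C s) X"
    using comp_hom[OF rh] comp_hom[OF sh] p by auto
  note t = tuple_props[OF comp_hom[OF a r1] comp_hom[OF b s2]]
  have eh: "e \<in> hom (Dom C a) (Dom C m)"
  proof -
    have e': "e \<in> hom (Dom C e) (Dom C m)" using regular_epi_hom[OF e(1)] e(2) by simp
    have "Dom C (m \<cdot> e) = Dom C e" using homD(2)[OF comp_hom[OF e' monic_hom[OF m]]] .
    then show ?thesis using e' homD(2)[OF t(1)] me by simp
  qed
  have "Cod C m = prd X X" using homD(3)[OF comp_hom[OF eh monic_hom[OF m]]] me homD(3)[OF t(1)] by simp
  then show mh: "m \<in> hom (Dom C m) (prd X X)" using monic_hom[OF m] by simp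
  show "(\<exists>u\<in>hom U (Dom C m). pr1 X X \<cdot> (m \<cdot> u) = x \<and> pr2 X X \<cdot> (m \<cdot> u) = z) \<longleftrightarrow>
      (\<exists>c y. cover c \<and> Cod C c = U \<and> y \<in> hom (Dom C c) X \<and>
         holds X R (x \<cdot> c) y \<and> holds X S y (z \<cdot> c))" (is "?L \<longleftrightarrow> ?R")
    if x: "x \<in> hom U X" and z: "z \<in> hom U X"
  proof
    assume ?L
    then obtain u where u: "u \<in> hom U (Dom C m)" "pr1 X X \<cdot> (m \<cdot> u) = x" "pr2 X X \<cdot> (m \<cdot> u) = z" by blast
    obtain c w where c: "cover c" "Cod C c = U" "w \<in> hom (Dom C c) (Dom C a)" "e \<cdot> w = u \<cdot> c"
      using cover_pullback[OF regular_epi_cover[OF e(1)], of u U] u(1) e(2) homD(2)[OF eh] by metis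
    have ch: "c \<in> hom (Dom C c) U" using cover_hom[OF c(1)] c(2) by simp
    note mu = comp_hom[OF u(1) mh]
    have eq: "(m \<cdot> u) \<cdot> c = tuple X (pr1 X X \<cdot> r \<cdot> a) (pr2 X X \<cdot> s \<cdot> b) \<cdot> w"
      using assoc[OF ch u(1) mh] assoc[OF c(3) eh mh] c(4) me by simp
    have xc: "x \<cdot> c = pr1 X X \<cdot> (r \<cdot> (a \<cdot> w))"
    proof -
      have "x \<cdot> c = pr1 X X \<cdot> ((m \<cdot> u) \<cdot> c)" using assoc[OF ch mu p(1)] u(2) by simp
      also have "\<dots> = (pr1 X X \<cdot> r \<cdot> a) \<cdot> w" unfolding eq using assoc[OF c(3) t(1) p(1)] t(2) by simp
      also have "\<dots> = pr1 X X \<cdot> (r \<cdot> (a \<cdot> w))"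
        using assoc[OF c(3) a r1] assoc[OF comp_hom[OF c(3) a] rh p(1)] by simp
      finally show ?thesis .
    qed
    have zc: "z \<cdot> c = pr2 X X \<cdot> (s \<cdot> (b \<cdot> w))"
    proof -
      have "z \<cdot> c = pr2 X X \<cdot> ((m \<cdot> u) \<cdot> c)" using assoc[OF ch mu p(2)] u(3) by simp
      also have "\<dots> = (pr2 X X \<cdot> s \<cdot> b) \<cdot> w" unfolding eq using assoc[OF c(3) t(1) p(2)] t(3) by simp
      also have "\<dots> = pr2 X X \<cdot> (s \<cdot> (b \<cdot> w))"
        using assoc[OF c(3) b s2] assoc[OF comp_hom[OF c(3) b] sh p(2)] by simp
      finally show ?thesis .
    qed
    let ?y = "pr2 X X \<cdot> (r \<cdot> (a \<cdot> w))"
    have y: "?y = pr1 X X \<cdot> (s \<cdot> (b \<cdot> w))"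
      using assoc[OF c(3) a r2] assoc[OF c(3) b s1] assoc[OF comp_hom[OF c(3) a] rh p(2)]
        assoc[OF comp_hom[OF c(3) b] sh p(1)] h(5) by simp
    have yh: "?y \<in> hom (Dom C c) X" using comp_hom[OF comp_hom[OF comp_hom[OF c(3) a] rh] p(2)] .
    have "holds X R (x \<cdot> c) ?y"
      using holds_iff[OF R r comp_hom[OF ch x]] xc comp_hom[OF c(3) a] by auto
    moreover have "holds X S ?y (z \<cdot> c)"
      using holds_iff[OF S s yh] y zc comp_hom[OF c(3) b] by auto
    ultimately show ?R using c yh by blast
  next
    assume ?R
    then obtain c y where c: "cover c" "Cod C c = U" and y: "y \<in> hom (Dom C c) X"
      and R': "holds X R (x \<cdot> c) y" and S': "holds X S y (z \<cdot> c)" by blast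
    have ch: "c \<in> hom (Dom C c) U" using cover_hom[OF c(1)] c(2) by simp
    obtain k where k: "k \<in> hom (Dom C c) (Dom C r)" "pr1 X X \<cdot> (r \<cdot> k) = x \<cdot> c" "pr2 X X \<cdot> (r \<cdot> k) = y"
      using R' holds_iff[OF R r comp_hom[OF ch x]] by blast
    obtain l where l: "l \<in> hom (Dom C c) (Dom C s)" "pr1 X X \<cdot> (s \<cdot> l) = y" "pr2 X X \<cdot> (s \<cdot> l) = z \<cdot> c"
      using S' holds_iff[OF S s y] by blast
    have "(pr2 X X \<cdot> r) \<cdot> k = (pr1 X X \<cdot> s) \<cdot> l"
      using assoc[OF k(1) rh p(2)] assoc[OF l(1) sh p(1)] k l by simp
    then obtain q where q: "q \<in> hom (Dom C c) (Dom C a)" "a \<cdot> q = k" "b \<cdot> q = l"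
      using pullback_lift[OF pb, of k "Dom C c" l] k(1) l(1) homD[OF r2] homD[OF s1] by metis
    note xz = tuple_props[OF x z]
    have "tuple X x z \<cdot> c = tuple X (pr1 X X \<cdot> r \<cdot> a) (pr2 X X \<cdot> s \<cdot> b) \<cdot> q"
    proof (rule pair_eqI[OF X comp_hom[OF ch xz(1)] comp_hom[OF q(1) t(1)]])
      show "pr1 X X \<cdot> (tuple X x z \<cdot> c) = pr1 X X \<cdot> (tuple X (pr1 X X \<cdot> r \<cdot> a) (pr2 X X \<cdot> s \<cdot> b) \<cdot> q)"
        using assoc[OF ch xz(1) p(1)] assoc[OF q(1) t(1) p(1)] xz(2) t(2) assoc[OF q(1) a r1]
          assoc[OF k(1) rh p(1)] q(2) k(2) by simp
      show "pr2 X X \<cdot> (tuple X x z \<cdot> c) = pr2 X X \<cdot> (tuple X (pr1 X X \<cdot> r \<cdot> a) (pr2 X X \<cdot> s \<cdot> b) \<cdot> q)"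
        using assoc[OF ch xz(1) p(2)] assoc[OF q(1) t(1) p(2)] xz(3) t(3) assoc[OF q(1) b s2]
          assoc[OF l(1) sh p(2)] q(3) l(3) by simp
    qed
    then have "m \<cdot> (e \<cdot> q) = tuple X x z \<cdot> c" using assoc[OF q(1) eh mh] me by simp
    then obtain u where "u \<in> hom U (Dom C m)" "m \<cdot> u = tuple X x z"
      using cover_factor[OF c(1) m, of "tuple X x z" "e \<cdot> q"] xz(1) c(2) comp_hom[OF q(1) eh] homD(3)[OF mh]
      by metis
    then show ?L using xz by metis
  qed
qed

lemma relcomp_rel:
  assumes X: "X \<in> Obj C" and R: "R \<in> rels X" and S: "S \<in> rels X"
  shows "relcomp X S R \<in> rels X"
    and "x \<in> hom U X \<Longrightarrow> z \<in> hom U X \<Longrightarrow> holds X (relcomp X S R) x z \<longleftrightarrow>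
      (\<exists>c y. cover c \<and> Cod C c = U \<and> y \<in> hom (Dom C c) X \<and>
         holds X R (x \<cdot> c) y \<and> holds X S y (z \<cdot> c))"
proof -
  obtain r s where r: "r \<in> R" and s: "s \<in> S" using rels_nonempty R S by blast
  note rh = rels_hom[OF R r] and sh = rels_hom[OF S s] and p = pr_hom[OF X]
  obtain a b where pb: "is_pullback (pr2 X X \<cdot> r) (pr1 X X \<cdot> s) a b"
    using pullback_exists homD[OF comp_hom[OF rh p(2)]] homD[OF comp_hom[OF sh p(1)]] by metis
  note h = pullback_homs[OF pb]
  have a: "a \<in> hom (Dom C a) (Dom C r)" and b: "b \<in> hom (Dom C a) (Dom C s)"
    using h(3,4) homD[OF comp_hom[OF rh p(2)]] homD[OF comp_hom[OF sh p(1)]] by auto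
  note t = tuple_props[OF comp_hom[OF a comp_hom[OF rh p(1)]] comp_hom[OF b comp_hom[OF sh p(2)]]]
  obtain m e I where me: "monic m" "regular_epi e" "e \<in> hom (Dom C a) I" "m \<in> hom I (prd X X)"
    "m \<cdot> e = tuple X (pr1 X X \<cdot> r \<cdot> a) (pr2 X X \<cdot> s \<cdot> b)"
    using image_factorization[OF t(1)] .
  have I: "I = Dom C m" "Cod C e = Dom C m" using homD[OF me(3)] homD[OF me(4)] by auto
  have mh: "m \<in> hom (Dom C m) (prd X X)" using me I by simp
  note H = holds_pullback_iff(2)[OF X R S r s pb me(2) I(2) me(1,5)]
  have M: "subobj m \<in> rels X" using subobj_in_rels[OF me(4,1)] .
  have mm: "m \<in> subobj m" using subobj_self[OF me(1)] .
  have "relcomp X S R = subobj m"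
  proof (intro set_eqI iffI)
    fix k assume "k \<in> subobj m"
    then obtain u where k: "monic k" and u: "u \<in> hom (Dom C k) (Dom C m)" "iso u" "k = m \<cdot> u"
      unfolding subobj_def by blast
    then obtain v where v: "v \<in> hom (Dom C m) (Dom C k)" "v \<cdot> u = Ident C (Dom C k)"
      "u \<cdot> v = Ident C (Dom C m)"
      using homD[OF u(1)] unfolding iso_def by metis
    have e: "e \<in> hom (Dom C a) (Dom C m)" using me(3) I by simp
    have "regular_epi (v \<cdot> e)"
      using regular_epi_iso_comp[OF me(2), of v "Dom C k" u] u(1) v I(2) by simp
    moreover have "k \<cdot> (v \<cdot> e) = m \<cdot> e"
    proof -
      have kh: "k \<in> hom (Dom C k) (prd X X)" using comp_hom[OF u(1) mh] u(3) by simp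
      have "k \<cdot> (v \<cdot> e) = (k \<cdot> v) \<cdot> e" using assoc[OF e v(1) kh] by simp
      also have "k \<cdot> v = m" using u(3) assoc[OF v(1) u(1) mh] v(3) comp_ident[OF mh] by simp
      finally show ?thesis .
    qed
    moreover have "Cod C (v \<cdot> e) = Dom C k" using homD(3)[OF comp_hom[OF e v(1)]] .
    ultimately show "k \<in> relcomp X S R"
      unfolding relcomp_def using k r s pb me(5) by auto metis
  next
    fix k assume "k \<in> relcomp X S R"
    then obtain r' s' a' b' e' where k: "monic k" "r' \<in> R" "s' \<in> S"
      "is_pullback (pr2 X X \<cdot> r') (pr1 X X \<cdot> s') a' b'" "regular_epi e'" "Cod C e' = Dom C k"
      "k \<cdot> e' = tuple X (pr1 X X \<cdot> r' \<cdot> a') (pr2 X X \<cdot> s' \<cdot> b')"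
      unfolding relcomp_def by blast
    note hk = holds_pullback_iff[OF X R S k(2-6,1,7)]
    have K: "subobj k \<in> rels X" using subobj_in_rels[OF hk(1) k(1)] .
    have kk: "k \<in> subobj k" using subobj_self[OF k(1)] .
    have "holds X (subobj k) x z \<longleftrightarrow> holds X (subobj m) x z" if "x \<in> hom U X" "z \<in> hom U X" for x z U
      using H[OF that] hk(2)[OF that] holds_iff[OF K kk that(1)] holds_iff[OF M mm that(1)] by simp
    then have "subobj k = subobj m"
      using incl_antisym[OF K M] incl_iff[OF X K M] incl_iff[OF X M K] by blast
    then show "k \<in> subobj m" using kk by simp
  qed
  then show "relcomp X S R \<in> rels X"
    and "x \<in> hom U X \<Longrightarrow> z \<in> hom U X \<Longrightarrow> holds X (relcomp X S R) x z \<longleftrightarrow>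
      (\<exists>c y. cover c \<and> Cod C c = U \<and> y \<in> hom (Dom C c) X \<and>
         holds X R (x \<cdot> c) y \<and> holds X S y (z \<cdot> c))"
    using M H[of x U z] holds_iff[OF M mm, of x U z] by auto
qed

section \<open>Constructing relations and objects of chains\<close>

lemma inverse_image_rel:
  assumes Q: "Q \<in> rels X" and f: "f \<in> hom Z X" and g: "g \<in> hom Z X"
  shows "\<exists>R\<in>rels Z. \<forall>U. \<forall>u\<in>hom U Z. \<forall>v\<in>hom U Z. holds Z R u v \<longleftrightarrow> holds X Q (f \<cdot> u) (g \<cdot> v)"
proof -
  have Z: "Z \<in> Obj C" and X: "X \<in> Obj C" using homD[OF f] by auto
  note p = pr_hom[OF X] and pz = pr_hom[OF Z]
  obtain q where q: "q \<in> Q" using rels_nonempty[OF Q] by blast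
  note qh = rels_hom[OF Q q]
  note t = tuple_props[OF comp_hom[OF pz(1) f] comp_hom[OF pz(2) g]]
  let ?t = "tuple X (f \<cdot> pr1 Z Z) (g \<cdot> pr2 Z Z)"
  obtain m k where pb: "is_pullback ?t q m k" using pullback_exists homD[OF t(1)] homD[OF qh] by metis
  have mon: "monic m" using pullback_monic[OF pb] rels_monic[OF Q q] by blast
  note h = pullback_homs[OF pb]
  have mh: "m \<in> hom (Dom C m) (prd Z Z)" using h(3) homD[OF t(1)] by simp
  let ?R = "subobj m"
  have R: "?R \<in> rels Z" using subobj_in_rels[OF mh mon] .
  have tw: "pr1 X X \<cdot> (?t \<cdot> w) = f \<cdot> (pr1 Z Z \<cdot> w)" "pr2 X X \<cdot> (?t \<cdot> w) = g \<cdot> (pr2 Z Z \<cdot> w)"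
    if w: "w \<in> hom U (prd Z Z)" for w U
    using assoc[OF w t(1)] p t(2,3) assoc[OF w pz(1) f] assoc[OF w pz(2) g] by metis+
  have "holds Z ?R u v \<longleftrightarrow> holds X Q (f \<cdot> u) (g \<cdot> v)" if u: "u \<in> hom U Z" and v: "v \<in> hom U Z" for U u v
  proof
    assume "holds Z ?R u v"
    then obtain w where w: "w \<in> hom U (Dom C m)" "pr1 Z Z \<cdot> (m \<cdot> w) = u" "pr2 Z Z \<cdot> (m \<cdot> w) = v"
      using holds_iff[OF R subobj_self[OF mon] u] by blast
    have "?t \<cdot> (m \<cdot> w) = q \<cdot> (k \<cdot> w)"
      using assoc[OF w(1) mh t(1)] assoc[OF w(1) h(4) qh] h(5) by simp
    then show "holds X Q (f \<cdot> u) (g \<cdot> v)"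
      using holds_iff[OF Q q comp_hom[OF u f]] tw[OF comp_hom[OF w(1) mh]] w comp_hom[OF w(1) h(4)] by metis
  next
    assume "holds X Q (f \<cdot> u) (g \<cdot> v)"
    then obtain y where y: "y \<in> hom U (Dom C q)" "pr1 X X \<cdot> (q \<cdot> y) = f \<cdot> u" "pr2 X X \<cdot> (q \<cdot> y) = g \<cdot> v"
      using holds_iff[OF Q q comp_hom[OF u f]] by blast
    note uv = tuple_props[OF u v]
    have "?t \<cdot> tuple Z u v = q \<cdot> y"
      by (rule pair_eqI[OF X comp_hom[OF uv(1) t(1)] comp_hom[OF y(1) qh]])
        (use tw[OF uv(1)] uv y in auto)
    then obtain w where "w \<in> hom U (Dom C m)" "m \<cdot> w = tuple Z u v"
      using pullback_lift[OF pb, of "tuple Z u v" U y] uv(1) y(1) homD[OF t(1)] by metis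
    then show "holds Z ?R u v" using holds_iff[OF R subobj_self[OF mon] u] uv by metis
  qed
  then show ?thesis using R by blast
qed

lemma intersection_rel:
  assumes X: "X \<in> Obj C" and R: "R \<in> rels X" and S: "S \<in> rels X"
  shows "\<exists>T\<in>rels X. \<forall>U. \<forall>a\<in>hom U X. \<forall>b\<in>hom U X. holds X T a b \<longleftrightarrow> holds X R a b \<and> holds X S a b"
proof -
  obtain r s where r: "r \<in> R" and s: "s \<in> S" using rels_nonempty R S by blast
  note rh = rels_hom[OF R r] and sh = rels_hom[OF S s]
  obtain k l where pb: "is_pullback r s k l" using pullback_exists homD[OF rh] homD[OF sh] by metis
  note h = pullback_homs[OF pb]
  have mon: "monic (r \<cdot> k)"
    using monic_comp pullback_monic[OF pb] rels_monic[OF R r] rels_monic[OF S s] homD(3)[OF h(3)] by metis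
  note mh = comp_hom[OF h(3) rh]
  let ?T = "subobj (r \<cdot> k)"
  have T: "?T \<in> rels X" using subobj_in_rels[OF mh mon] .
  have "holds X ?T a b \<longleftrightarrow> holds X R a b \<and> holds X S a b"
    if a: "a \<in> hom U X" and b: "b \<in> hom U X" for U a b
  proof -
    have "holds X ?T a b \<longleftrightarrow>
      (\<exists>u\<in>hom U (Dom C k). pr1 X X \<cdot> (r \<cdot> k \<cdot> u) = a \<and> pr2 X X \<cdot> (r \<cdot> k \<cdot> u) = b)"
      using holds_iff[OF T subobj_self[OF mon] a] homD(2)[OF mh] by simp
    also have "\<dots> \<longleftrightarrow> holds X R a b \<and> holds X S a b"
    proof
      assume "\<exists>u\<in>hom U (Dom C k). pr1 X X \<cdot> (r \<cdot> k \<cdot> u) = a \<and> pr2 X X \<cdot> (r \<cdot> k \<cdot> u) = b"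
      then obtain u where u: "u \<in> hom U (Dom C k)" "pr1 X X \<cdot> (r \<cdot> k \<cdot> u) = a"
        "pr2 X X \<cdot> (r \<cdot> k \<cdot> u) = b" by blast
      have "r \<cdot> k \<cdot> u = r \<cdot> (k \<cdot> u)" "r \<cdot> k \<cdot> u = s \<cdot> (l \<cdot> u)"
        using assoc[OF u(1) h(3) rh] assoc[OF u(1) h(4) sh] h(5) by auto
      then show "holds X R a b \<and> holds X S a b"
        using holds_iff[OF R r a] holds_iff[OF S s a] u comp_hom[OF u(1) h(3)] comp_hom[OF u(1) h(4)]
        by metis
    next
      assume "holds X R a b \<and> holds X S a b"
      then obtain x y where x: "x \<in> hom U (Dom C r)" "pr1 X X \<cdot> (r \<cdot> x) = a" "pr2 X X \<cdot> (r \<cdot> x) = b"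
        and y: "y \<in> hom U (Dom C s)" "pr1 X X \<cdot> (s \<cdot> y) = a" "pr2 X X \<cdot> (s \<cdot> y) = b"
        using holds_iff[OF R r a] holds_iff[OF S s a] by blast
      have "r \<cdot> x = s \<cdot> y"
        by (rule pair_eqI[OF X comp_hom[OF x(1) rh] comp_hom[OF y(1) sh]]) (use x y in auto)
      then obtain u where "u \<in> hom U (Dom C k)" "k \<cdot> u = x"
        using pullback_lift[OF pb x(1) y(1)] by blast
      then show "\<exists>u\<in>hom U (Dom C k). pr1 X X \<cdot> (r \<cdot> k \<cdot> u) = a \<and> pr2 X X \<cdot> (r \<cdot> k \<cdot> u) = b"
        using assoc[OF _ h(3) rh] x by auto
    qed
    finally show ?thesis .
  qed
  then show ?thesis using T by blast
qed

lemma total_rel: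
  assumes X: "X \<in> Obj C"
  shows "\<exists>T\<in>rels X. \<forall>U. \<forall>a\<in>hom U X. \<forall>b\<in>hom U X. holds X T a b"
proof -
  have P: "prd X X \<in> Obj C" using homD(4)[OF pr_hom(1)[OF X]] .
  have mon: "monic (Ident C (prd X X))" using monic_ident[OF P] .
  have T: "subobj (Ident C (prd X X)) \<in> rels X" using subobj_in_rels[OF ident_hom[OF P] mon] .
  have "holds X (subobj (Ident C (prd X X))) a b" if a: "a \<in> hom U X" and b: "b \<in> hom U X" for U a b
    using holds_iff[OF T subobj_self[OF mon] a] tuple_props[OF a b] ident_comp[OF tuple_props(1)[OF a b]]
      Dom_Ident[OF P] by metis
  then show ?thesis using T by blast
qed

text \<open>The predicate \<open>P\<close> selects the indices that take part, so that the conditions on the even or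
  on the odd places of a chain come from one family of relations and arrows.\<close>

lemma rel_comprehension:
  fixes k :: nat
  assumes Z: "Z \<in> Obj C"
    and "\<And>j. j < k \<Longrightarrow> Q j \<in> rels X \<and> f j \<in> hom Z X \<and> g j \<in> hom Z X"
  shows "\<exists>R\<in>rels Z. \<forall>U. \<forall>u\<in>hom U Z. \<forall>v\<in>hom U Z. holds Z R u v \<longleftrightarrow>
    (\<forall>j<k. P j \<longrightarrow> holds X (Q j) (f j \<cdot> u) (g j \<cdot> v))"
  using assms(2)
proof (induction k)
  case 0
  then show ?case using total_rel[OF Z] by simp
next
  case (Suc k)
  then obtain R where R: "R \<in> rels Z" "\<forall>U. \<forall>u\<in>hom U Z. \<forall>v\<in>hom U Z. holds Z R u v \<longleftrightarrow>
    (\<forall>j<k. P j \<longrightarrow> holds X (Q j) (f j \<cdot> u) (g j \<cdot> v))" by force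
  show ?case
  proof (cases "P k")
    case False
    then show ?thesis using R less_Suc_eq by metis
  next
    case True
    obtain S where S: "S \<in> rels Z" "\<forall>U. \<forall>u\<in>hom U Z. \<forall>v\<in>hom U Z. holds Z S u v \<longleftrightarrow>
      holds X (Q k) (f k \<cdot> u) (g k \<cdot> v)"
      using inverse_image_rel[of "Q k" X "f k" Z "g k"] Suc.prems[of k] by auto
    obtain T where T: "T \<in> rels Z" "\<forall>U. \<forall>u\<in>hom U Z. \<forall>v\<in>hom U Z. holds Z T u v \<longleftrightarrow>
      holds Z R u v \<and> holds Z S u v"
      using intersection_rel[OF Z R(1) S(1)] by blast
    have "holds Z T u v \<longleftrightarrow> (\<forall>j<Suc k. P j \<longrightarrow> holds X (Q j) (f j \<cdot> u) (g j \<cdot> v))"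
      if "u \<in> hom U Z" "v \<in> hom U Z" for U u v
      using that R(2) S(2) T(2) True less_Suc_eq by metis
    then show ?thesis using T(1) by blast
  qed
qed

text \<open>The object \<open>Z\<close> of chains \<open>x\<^sub>0 Q\<^sub>0 x\<^sub>1 Q\<^sub>1 \<dots> x\<^sub>k\<close>, an iterated pullback, with the arrows \<open>c\<^sub>i\<close>
  that extract the entries.\<close>

lemma chain_object:
  assumes X: "X \<in> Obj C" and Q: "\<And>i. i < k \<Longrightarrow> Q i \<in> rels X"
  shows "\<exists>Z c. Z \<in> Obj C \<and> (\<forall>i\<le>k. c i \<in> hom Z X) \<and> (\<forall>i<k. holds X (Q i) (c i) (c (Suc i))) \<and>
    (\<forall>U x. (\<forall>i\<le>k. x i \<in> hom U X) \<longrightarrow> (\<forall>i<k. holds X (Q i) (x i) (x (Suc i))) \<longrightarrow>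
       (\<exists>u\<in>hom U Z. \<forall>i\<le>k. c i \<cdot> u = x i))"
  using Q
proof (induction k)
  case 0
  show ?case
    by (rule exI[of _ X], rule exI[of _ "\<lambda>_. Ident C X"]) (use X ident_hom ident_comp in auto)
next
  case (Suc k)
  have "\<And>i. i < k \<Longrightarrow> Q i \<in> rels X" using Suc.prems by simp
  from Suc.IH[OF this] obtain Z c where Z: "Z \<in> Obj C" and c: "\<forall>i\<le>k. c i \<in> hom Z X"
    and cQ: "\<forall>i<k. holds X (Q i) (c i) (c (Suc i))"
    and univ: "\<forall>U x. (\<forall>i\<le>k. x i \<in> hom U X) \<longrightarrow> (\<forall>i<k. holds X (Q i) (x i) (x (Suc i))) \<longrightarrow>
       (\<exists>u\<in>hom U Z. \<forall>i\<le>k. c i \<cdot> u = x i)" by blast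
  note p = pr_hom[OF X]
  have Qk: "Q k \<in> rels X" using Suc.prems by simp
  obtain q where q: "q \<in> Q k" using rels_nonempty[OF Qk] by blast
  note qh = rels_hom[OF Qk q]
  note q1 = comp_hom[OF qh p(1)] and q2 = comp_hom[OF qh p(2)]
  have ck: "c k \<in> hom Z X" using c by blast
  obtain a b where pb: "is_pullback (c k) (pr1 X X \<cdot> q) a b"
    using pullback_exists homD[OF ck] homD[OF q1] by metis
  note h = pullback_homs[OF pb]
  have a: "a \<in> hom (Dom C a) Z" and b: "b \<in> hom (Dom C a) (Dom C q)"
    using h homD[OF ck] homD[OF q1] by auto
  let ?c = "\<lambda>i. if i \<le> k then c i \<cdot> a else (pr2 X X \<cdot> q) \<cdot> b"
  have 1: "\<forall>i\<le>Suc k. ?c i \<in> hom (Dom C a) X" using comp_hom[OF a] c comp_hom[OF b q2] by simp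
  have 2: "holds X (Q i) (?c i) (?c (Suc i))" if "i < Suc k" for i
  proof (cases "i = k")
    case True
    have "holds X (Q k) ((pr1 X X \<cdot> q) \<cdot> b) ((pr2 X X \<cdot> q) \<cdot> b)"
      using holds_precomp[OF Qk q1 q2 holds_self[OF X Qk q] b] .
    then show ?thesis using True h(5) by simp
  next
    case False
    then have i: "i < k" using that by simp
    then show ?thesis using holds_precomp[OF _ _ _ _ a, of "Q i" X "c i" "c (Suc i)"] c cQ Suc.prems by simp
  qed
  have 3: "\<exists>u\<in>hom U (Dom C a). \<forall>i\<le>Suc k. ?c i \<cdot> u = x i"
    if x: "\<forall>i\<le>Suc k. x i \<in> hom U X" and xQ: "\<forall>i<Suc k. holds X (Q i) (x i) (x (Suc i))" for U x
  proof -
    have "\<forall>i\<le>k. x i \<in> hom U X" "\<forall>i<k. holds X (Q i) (x i) (x (Suc i))" using x xQ by auto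
    then obtain v where v: "v \<in> hom U Z" "\<forall>i\<le>k. c i \<cdot> v = x i"
      using univ[THEN spec, of U, THEN spec, of x] by blast
    have "holds X (Q k) (x k) (x (Suc k))" "x k \<in> hom U X" using x xQ by auto
    then obtain w where w: "w \<in> hom U (Dom C q)" "pr1 X X \<cdot> (q \<cdot> w) = x k" "pr2 X X \<cdot> (q \<cdot> w) = x (Suc k)"
      using holds_iff[OF Qk q] by blast
    have "c k \<cdot> v = (pr1 X X \<cdot> q) \<cdot> w" using assoc[OF w(1) qh p(1)] w v by simp
    then obtain u where u: "u \<in> hom U (Dom C a)" "a \<cdot> u = v" "b \<cdot> u = w"
      using pullback_lift[OF pb, of v U w] v(1) w(1) homD[OF ck] homD[OF q1] by metis
    have "?c i \<cdot> u = x i" if "i \<le> Suc k" for i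
    proof (cases "i \<le> k")
      case True
      then have ci: "c i \<in> hom Z X" using c by blast
      show ?thesis using True assoc[OF u(1) a ci] u v by simp
    next
      case False
      then have "i = Suc k" using that by simp
      then show ?thesis using assoc[OF u(1) b q2] assoc[OF w(1) qh p(2)] u w by simp
    qed
    then show ?thesis using u(1) by blast
  qed
  show ?case
    by (rule exI[of _ "Dom C a"], rule exI[of _ ?c]) (use 1 2 3 homD(4)[OF a] in blast)
qed

end

context regular_category
begin

section \<open>The calculus of composite relations\<close>

lemma holds_relcompI:
  assumes R: "R \<in> rels X" and S: "S \<in> rels X"
    and x: "x \<in> hom U X" and y: "y \<in> hom U X" and z: "z \<in> hom U X"
    and "holds X R x y" "holds X S y z"
  shows "holds X (relcomp X S R) x z"
proof -
  have X: "X \<in> Obj C" and U: "U \<in> Obj C" using homD[OF x] by auto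
  show ?thesis
    unfolding relcomp_rel(2)[OF X R S x z]
    using assms comp_ident[OF x] comp_ident[OF z] cover_ident[OF U] Dom_Ident[OF U] Cod_Ident[OF U]
    by (intro exI[of _ "Ident C U"] exI[of _ y]) simp
qed

lemma holds_relcompE:
  assumes R: "R \<in> rels X" and S: "S \<in> rels X" and x: "x \<in> hom U X" and z: "z \<in> hom U X"
    and "holds X (relcomp X S R) x z"
  obtains c y where "cover c" "Cod C c = U" "c \<in> hom (Dom C c) U" "y \<in> hom (Dom C c) X"
    "holds X R (x \<cdot> c) y" "holds X S y (z \<cdot> c)"
  using assms relcomp_rel(2)[OF homD(5)[OF x] R S x z] cover_hom by metis

lemma inclI:
  assumes "X \<in> Obj C" "R \<in> rels X" "S \<in> rels X"
    and "\<And>U a b. a \<in> hom U X \<Longrightarrow> b \<in> hom U X \<Longrightarrow> holds X R a b \<Longrightarrow> holds X S a b"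
  shows "incl R S"
  using assms incl_iff by blast

lemma inclD:
  assumes "incl R S" "R \<in> rels X" "S \<in> rels X" "a \<in> hom U X" "b \<in> hom U X" "holds X R a b"
  shows "holds X S a b"
  using assms incl_iff[OF homD(5)[OF assms(4)] assms(2,3)] by blast

lemma incl_refl: "X \<in> Obj C \<Longrightarrow> R \<in> rels X \<Longrightarrow> incl R R"
  using inclI by blast

lemma incl_trans:
  assumes "X \<in> Obj C" "R \<in> rels X" "S \<in> rels X" "T \<in> rels X" "incl R S" "incl S T"
  shows "incl R T"
  by (rule inclI[OF assms(1,2,4)]) (use inclD assms in metis)

lemma relcomp_mono:
  assumes X: "X \<in> Obj C" and R: "R \<in> rels X" "R' \<in> rels X" and S: "S \<in> rels X" "S' \<in> rels X"
    and "incl R R'" "incl S S'"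
  shows "incl (relcomp X S R) (relcomp X S' R')"
proof (rule inclI[OF X relcomp_rel(1)[OF X R(1) S(1)] relcomp_rel(1)[OF X R(2) S(2)]])
  fix U a b assume a: "a \<in> hom U X" and b: "b \<in> hom U X" and "holds X (relcomp X S R) a b"
  then obtain c y where c: "cover c" "Cod C c = U" "c \<in> hom (Dom C c) U" and y: "y \<in> hom (Dom C c) X"
    "holds X R (a \<cdot> c) y" "holds X S y (b \<cdot> c)"
    using holds_relcompE[OF R(1) S(1)] by blast
  note ac = comp_hom[OF c(3) a] and bc = comp_hom[OF c(3) b]
  show "holds X (relcomp X S' R') a b"
    using holds_local[OF relcomp_rel(1)[OF X R(2) S(2)] a b c(1,2)]
      holds_relcompI[OF R(2) S(2) ac y(1) bc] inclD[OF assms(6) R ac y(1,2)]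
      inclD[OF assms(7) S y(1) bc y(3)] by blast
qed

lemma relcomp_assoc:
  assumes X: "X \<in> Obj C" and R: "R \<in> rels X" and S: "S \<in> rels X" and T: "T \<in> rels X"
  shows "relcomp X T (relcomp X S R) = relcomp X (relcomp X T S) R"
proof -
  note SR = relcomp_rel(1)[OF X R S] and TS = relcomp_rel(1)[OF X S T]
  note L = relcomp_rel(1)[OF X SR T] and L' = relcomp_rel(1)[OF X R TS]
  show ?thesis
  proof (rule incl_antisym[OF L L' inclI[OF X L L'] inclI[OF X L' L]])
    fix U a b assume a: "a \<in> hom U X" and b: "b \<in> hom U X"
    show "holds X (relcomp X (relcomp X T S) R) a b" if h: "holds X (relcomp X T (relcomp X S R)) a b"
    proof -
      obtain c z where c: "cover c" "Cod C c = U" "c \<in> hom (Dom C c) U" and z: "z \<in> hom (Dom C c) X"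
        "holds X (relcomp X S R) (a \<cdot> c) z" "holds X T z (b \<cdot> c)"
        using holds_relcompE[OF SR T a b h] .
      note ac = comp_hom[OF c(3) a] and bc = comp_hom[OF c(3) b]
      obtain d y where d: "cover d" "Cod C d = Dom C c" "d \<in> hom (Dom C d) (Dom C c)"
        and y: "y \<in> hom (Dom C d) X" "holds X R (a \<cdot> c \<cdot> d) y" "holds X S y (z \<cdot> d)"
        using holds_relcompE[OF R S ac z(1,2)] .
      have "holds X (relcomp X T S) y (b \<cdot> c \<cdot> d)"
        using holds_relcompI[OF S T y(1) comp_hom[OF d(3) z(1)] comp_hom[OF d(3) bc] y(3)]
          holds_precomp[OF T z(1) bc z(3) d(3)] by blast
      then have "holds X (relcomp X (relcomp X T S) R) (a \<cdot> c \<cdot> d) (b \<cdot> c \<cdot> d)"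
        using holds_relcompI[OF R TS comp_hom[OF d(3) ac] y(1) comp_hom[OF d(3) bc] y(2)] by blast
      then show ?thesis
        using holds_local[OF L' a b c(1,2)] holds_local[OF L' ac bc d(1,2)] by blast
    qed
    show "holds X (relcomp X T (relcomp X S R)) a b" if h: "holds X (relcomp X (relcomp X T S) R) a b"
    proof -
      obtain c y where c: "cover c" "Cod C c = U" "c \<in> hom (Dom C c) U" and y: "y \<in> hom (Dom C c) X"
        "holds X R (a \<cdot> c) y" "holds X (relcomp X T S) y (b \<cdot> c)"
        using holds_relcompE[OF R TS a b h] .
      note ac = comp_hom[OF c(3) a] and bc = comp_hom[OF c(3) b]
      obtain d z where d: "cover d" "Cod C d = Dom C c" "d \<in> hom (Dom C d) (Dom C c)"
        and z: "z \<in> hom (Dom C d) X" "holds X S (y \<cdot> d) z" "holds X T z (b \<cdot> c \<cdot> d)"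
        using holds_relcompE[OF S T y(1) bc y(3)] .
      have "holds X (relcomp X S R) (a \<cdot> c \<cdot> d) z"
        using holds_relcompI[OF R S comp_hom[OF d(3) ac] comp_hom[OF d(3) y(1)] z(1) _ z(2)]
          holds_precomp[OF R ac y(1,2) d(3)] by blast
      then have "holds X (relcomp X T (relcomp X S R)) (a \<cdot> c \<cdot> d) (b \<cdot> c \<cdot> d)"
        using holds_relcompI[OF SR T comp_hom[OF d(3) ac] z(1) comp_hom[OF d(3) bc] _ z(3)] by blast
      then show ?thesis
        using holds_local[OF L a b c(1,2)] holds_local[OF L ac bc d(1,2)] by blast
    qed
  qed
qed

lemma relcomp_diag:
  assumes X: "X \<in> Obj C" and R: "R \<in> rels X"
  shows "relcomp X R (diag X) = R" "relcomp X (diag X) R = R"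
proof -
  note D = diag_rel(1)[OF X]
  note RD = relcomp_rel(1)[OF X D R] and DR = relcomp_rel(1)[OF X R D]
  have refl: "holds X (diag X) a a" if "a \<in> hom U X" for a U using diag_rel(2)[OF X that that] by simp
  have "holds X R a b" if a: "a \<in> hom U X" and b: "b \<in> hom U X" and h: "holds X (relcomp X R (diag X)) a b" for U a b
  proof -
    obtain c y where c: "cover c" "Cod C c = U" "c \<in> hom (Dom C c) U" and y: "y \<in> hom (Dom C c) X"
      "holds X (diag X) (a \<cdot> c) y" "holds X R y (b \<cdot> c)"
      using holds_relcompE[OF D R a b h] .
    have "a \<cdot> c = y" using y diag_rel(2)[OF X comp_hom[OF c(3) a] y(1)] by simp
    then show ?thesis using holds_local[OF R a b c(1,2)] y(3) by simp
  qed
  then show "relcomp X R (diag X) = R"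
    using incl_antisym[OF RD R inclI[OF X RD R] inclI[OF X R RD]] holds_relcompI[OF D R] refl by blast
  have "holds X R a b" if a: "a \<in> hom U X" and b: "b \<in> hom U X" and h: "holds X (relcomp X (diag X) R) a b" for U a b
  proof -
    obtain c y where c: "cover c" "Cod C c = U" "c \<in> hom (Dom C c) U" and y: "y \<in> hom (Dom C c) X"
      "holds X R (a \<cdot> c) y" "holds X (diag X) y (b \<cdot> c)"
      using holds_relcompE[OF R D a b h] .
    have "y = b \<cdot> c" using y diag_rel(2)[OF X y(1) comp_hom[OF c(3) b]] by simp
    then show ?thesis using holds_local[OF R a b c(1,2)] y(2) by simp
  qed
  then show "relcomp X (diag X) R = R"
    using incl_antisym[OF DR R inclI[OF X DR R] inclI[OF X R DR]] holds_relcompI[OF R D] refl by blast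
qed

lemma reflexive_relD: "reflexive_rel X R \<Longrightarrow> R \<in> rels X" "reflexive_rel X R \<Longrightarrow> incl (diag X) R"
  unfolding reflexive_rel_def by auto

lemma reflexive_relcomp:
  assumes X: "X \<in> Obj C" and R: "reflexive_rel X R" and S: "reflexive_rel X S"
  shows "reflexive_rel X (relcomp X S R)"
proof -
  note Rr = reflexive_relD(1)[OF R] and Sr = reflexive_relD(1)[OF S]
  show ?thesis
    by (rule reflexive_relI[OF X relcomp_rel(1)[OF X Rr Sr]])
      (use holds_relcompI[OF Rr Sr] holds_refl[OF R] holds_refl[OF S] in blast)
qed

lemma incl_relcomp_left:
  assumes X: "X \<in> Obj C" and R: "reflexive_rel X R" and P: "P \<in> rels X"
  shows "incl P (relcomp X R P)"
  using relcomp_mono[OF X P P diag_rel(1)[OF X] reflexive_relD(1)[OF R] incl_refl[OF X P]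
      reflexive_relD(2)[OF R]] relcomp_diag[OF X P] by simp

section \<open>Alternating products as chains\<close>

text \<open>As \<open>R \<circ> \<Delta> = R\<close>, the recursion for alternating products holds from \<open>k = 0\<close> on, which spares the
  inductions below a separate case \<open>k = 1\<close>.\<close>

lemma altprod_Suc:
  assumes "X \<in> Obj C" "R \<in> rels X"
  shows "altprod X (Suc k) R S = relcomp X R (altprod X k S R)"
  using relcomp_diag[OF assms] by (cases k) auto

lemma altprod_rel:
  assumes "X \<in> Obj C" "R \<in> rels X" "S \<in> rels X"
  shows "altprod X k R S \<in> rels X"
  using assms
proof (induction k arbitrary: R S)
  case 0
  then show ?case using diag_rel by simp
next
  case (Suc k)
  then show ?case using altprod_Suc relcomp_rel(1) by simp
qed

lemma altprod_mono_Suc: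
  assumes X: "X \<in> Obj C" and "reflexive_rel X R" "reflexive_rel X S"
  shows "incl (altprod X k R S) (altprod X (Suc k) R S)"
  using assms(2,3)
proof (induction k arbitrary: R S)
  case 0
  then show ?case using reflexive_relD by simp
next
  case (Suc k)
  note R = reflexive_relD(1)[OF Suc.prems(1)] and S = reflexive_relD(1)[OF Suc.prems(2)]
  show ?case
    unfolding altprod_Suc[OF X R]
    using relcomp_mono[OF X altprod_rel[OF X S R] altprod_rel[OF X S R] R R]
      Suc.IH[OF Suc.prems(2,1)] incl_refl[OF X R] altprod_Suc[OF X S] by metis
qed

lemma altprod_double:
  assumes X: "X \<in> Obj C" and R: "R \<in> rels X" and S: "S \<in> rels X"
  shows "altprod X (2 * k) S R = altprod X k (relcomp X S R) (relcomp X S R)"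
proof (induction k)
  case 0
  show ?case by simp
next
  case (Suc k)
  have "altprod X (2 * Suc k) S R = relcomp X S (relcomp X R (altprod X (2 * k) S R))"
    using altprod_Suc[OF X R] altprod_Suc[OF X S] by simp
  also have "\<dots> = relcomp X (relcomp X S R) (altprod X (2 * k) S R)"
    using relcomp_assoc[OF X altprod_rel[OF X S R] R S] .
  also have "\<dots> = altprod X (Suc k) (relcomp X S R) (relcomp X S R)"
    using altprod_Suc[OF X relcomp_rel(1)[OF X R S]] Suc.IH by simp
  finally show ?case .
qed

text \<open>The last step of a chain is made in the leftmost factor \<open>R\<close>, since composites are read from
  right to left; hence step \<open>i\<close> out of \<open>k\<close> is in \<open>R\<close> exactly when \<open>k - i\<close> is odd.\<close>

lemma holds_altprodI:
  assumes "R \<in> rels X" "S \<in> rels X"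
    and "\<And>i. i \<le> k \<Longrightarrow> x i \<in> hom U X"
    and "\<And>i. i < k \<Longrightarrow> holds X (if odd (k - i) then R else S) (x i) (x (Suc i))"
  shows "holds X (altprod X k R S) (x 0) (x k)"
  using assms
proof (induction k arbitrary: R S)
  case 0
  then show ?case using diag_rel(2) homD(5) by (metis altprod.simps(1) le0)
next
  case (Suc k)
  note x0 = Suc.prems(3)[of 0]
  have X: "X \<in> Obj C" using homD[OF x0] by simp
  have "holds X (altprod X k S R) (x 0) (x k)"
  proof (rule Suc.IH[OF Suc.prems(2,1)])
    fix i assume "i < k"
    then show "holds X (if odd (k - i) then S else R) (x i) (x (Suc i))"
      using Suc.prems(4)[of i] by (simp add: Suc_diff_le split: if_splits)
  qed (use Suc.prems(3) in simp)
  moreover have "holds X R (x k) (x (Suc k))" using Suc.prems(4)[of k] by simp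
  ultimately show ?case
    unfolding altprod_Suc[OF X Suc.prems(1)]
    using holds_relcompI[OF altprod_rel[OF X Suc.prems(2,1)] Suc.prems(1) x0
        Suc.prems(3)[of k] Suc.prems(3)[of "Suc k"]] by simp
qed

lemma holds_altprodE:
  assumes "R \<in> rels X" "S \<in> rels X" "a \<in> hom U X" "b \<in> hom U X" "holds X (altprod X k R S) a b"
  shows "\<exists>c x. cover c \<and> Cod C c = U \<and> c \<in> hom (Dom C c) U \<and> (\<forall>i\<le>k. x i \<in> hom (Dom C c) X) \<and>
    x 0 = a \<cdot> c \<and> x k = b \<cdot> c \<and>
    (\<forall>i<k. holds X (if odd (k - i) then R else S) (x i) (x (Suc i)))"
  using assms
proof (induction k arbitrary: R S U a b)
  case 0
  have U: "U \<in> Obj C" and X: "X \<in> Obj C" using homD[OF 0(3)] by auto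
  have "a = b" using 0 diag_rel(2)[OF X] by simp
  then show ?case
    using 0(3) comp_ident[OF 0(3)] cover_ident[OF U] Dom_Ident[OF U] Cod_Ident[OF U] ident_hom[OF U]
    by (intro exI[of _ "Ident C U"] exI[of _ "\<lambda>_. a"]) simp
next
  case (Suc k)
  note R = Suc.prems(1) and S = Suc.prems(2) and a = Suc.prems(3) and b = Suc.prems(4)
  have X: "X \<in> Obj C" using homD[OF a] by simp
  have h: "holds X (relcomp X R (altprod X k S R)) a b" using Suc.prems(5) altprod_Suc[OF X R] by simp
  obtain c y where c: "cover c" "Cod C c = U" "c \<in> hom (Dom C c) U" and y: "y \<in> hom (Dom C c) X"
    "holds X (altprod X k S R) (a \<cdot> c) y" "holds X R y (b \<cdot> c)"
    using holds_relcompE[OF altprod_rel[OF X S R] R a b h] .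
  note ac = comp_hom[OF c(3) a] and bc = comp_hom[OF c(3) b]
  obtain d x where d: "cover d" "Cod C d = Dom C c" "d \<in> hom (Dom C d) (Dom C c)"
    and x: "\<forall>i\<le>k. x i \<in> hom (Dom C d) X" "x 0 = a \<cdot> c \<cdot> d" "x k = y \<cdot> d"
      "\<forall>i<k. holds X (if odd (k - i) then S else R) (x i) (x (Suc i))"
    using Suc.IH[OF S R ac y(1,2)] by blast
  let ?x = "x (Suc k := b \<cdot> c \<cdot> d)"
  have cd: "c \<cdot> d \<in> hom (Dom C d) U" using comp_hom[OF d(3) c(3)] .
  have D: "Dom C (c \<cdot> d) = Dom C d" "Cod C (c \<cdot> d) = U" using homD[OF cd] by auto
  have "holds X (if odd (Suc k - i) then R else S) (?x i) (?x (Suc i))" if "i < Suc k" for i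
  proof (cases "i = k")
    case True
    then show ?thesis using holds_precomp[OF R y(1) bc y(3) d(3)] x(3) by simp
  next
    case False
    then have "i < k" using that by simp
    moreover from this have "holds X (if odd (k - i) then S else R) (x i) (x (Suc i))" using x(4) by blast
    ultimately show ?thesis by (simp add: Suc_diff_le split: if_splits)
  qed
  moreover have "\<forall>i\<le>Suc k. ?x i \<in> hom (Dom C d) X" using x(1) comp_hom[OF d(3) bc] by simp
  moreover have "?x 0 = a \<cdot> (c \<cdot> d)" "?x (Suc k) = b \<cdot> (c \<cdot> d)"
    using x(2) assoc[OF d(3) c(3) a] assoc[OF d(3) c(3) b] by auto
  ultimately show ?case
    using cover_comp[OF d(1) c(1) d(2)] D cd
    by (intro exI[of _ "c \<cdot> d"] exI[of _ ?x] conjI allI impI) (simp_all only:)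
qed

section \<open>Transitive relations and congruences\<close>

lemma transitive_relI:
  assumes X: "X \<in> Obj C" and R: "R \<in> rels X"
    and tr: "\<And>U a b c. a \<in> hom U X \<Longrightarrow> b \<in> hom U X \<Longrightarrow> c \<in> hom U X \<Longrightarrow>
      holds X R a b \<Longrightarrow> holds X R b c \<Longrightarrow> holds X R a c"
  shows "transitive_rel X R"
proof -
  have "incl (relcomp X R R) R"
  proof (rule inclI[OF X relcomp_rel(1)[OF X R R] R])
    fix U a b assume a: "a \<in> hom U X" and b: "b \<in> hom U X" and h: "holds X (relcomp X R R) a b"
    obtain c y where c: "cover c" "Cod C c = U" "c \<in> hom (Dom C c) U" and y: "y \<in> hom (Dom C c) X"
      "holds X R (a \<cdot> c) y" "holds X R y (b \<cdot> c)"
      using holds_relcompE[OF R R a b h] .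
    show "holds X R a b"
      using holds_local[OF R a b c(1,2)] tr[OF comp_hom[OF c(3) a] y(1) comp_hom[OF c(3) b] y(2,3)] .
  qed
  then show ?thesis unfolding transitive_rel_def using R by blast
qed

lemma agreement_equivalence:
  fixes k :: nat
  assumes Z: "Z \<in> Obj C" and f: "\<And>j. j < k \<Longrightarrow> f j \<in> hom Z X"
  shows "\<exists>R. equivalence_rel Z R \<and> (\<forall>U. \<forall>u\<in>hom U Z. \<forall>v\<in>hom U Z. holds Z R u v \<longleftrightarrow>
    (\<forall>j<k. P j \<longrightarrow> f j \<cdot> u = f j \<cdot> v))"
proof -
  have "\<And>j. j < k \<Longrightarrow> diag X \<in> rels X \<and> f j \<in> hom Z X \<and> f j \<in> hom Z X"
    using f diag_rel(1) homD(5) by blast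
  from rel_comprehension[where Q = "\<lambda>_. diag X" and f = f and g = f and P = P, OF Z this] obtain R where R: "R \<in> rels Z"
    and h: "\<forall>U. \<forall>u\<in>hom U Z. \<forall>v\<in>hom U Z. holds Z R u v \<longleftrightarrow>
      (\<forall>j<k. P j \<longrightarrow> holds X (diag X) (f j \<cdot> u) (f j \<cdot> v))" by blast
  have H: "holds Z R u v \<longleftrightarrow> (\<forall>j<k. P j \<longrightarrow> f j \<cdot> u = f j \<cdot> v)"
    if u: "u \<in> hom U Z" and v: "v \<in> hom U Z" for U u v
  proof -
    have "holds X (diag X) (f j \<cdot> u) (f j \<cdot> v) \<longleftrightarrow> f j \<cdot> u = f j \<cdot> v" if "j < k" for j
      using diag_rel(2)[OF homD(5)[OF f[OF that]] comp_hom[OF u f[OF that]] comp_hom[OF v f[OF that]]] .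
    then show ?thesis using h u v by auto
  qed
  have "reflexive_rel Z R" using reflexive_relI[OF Z R] H by blast
  moreover have "transitive_rel Z R"
    by (rule transitive_relI[OF Z R]) (simp add: H)
  moreover have "symmetric_rel Z R"
    by (rule symmetric_relI[OF Z R]) (simp add: H)
  ultimately show ?thesis unfolding equivalence_rel_def preorder_rel_def using H by blast
qed

section \<open>Permutability and powers of reflexive relations\<close>

text \<open>Let \<open>x\<^sub>0 E x\<^sub>1 \<dots> E x\<^sub>m\<^sub>+\<^sub>1\<close>. The chains \<open>z\<^sub>i = (x\<^sub>1, \<dots>, x\<^sub>i, x\<^sub>i, x\<^sub>i\<^sub>+\<^sub>1, \<dots>, x\<^sub>m)\<close>, for
  \<open>i = 0, \<dots>, m+1\<close>, are elements of the object of chains with \<open>m+1\<close> entries, as \<open>E\<close> is reflexive.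
  Passing from \<open>z\<^sub>i\<close> to \<open>z\<^sub>i\<^sub>+\<^sub>1\<close> changes the entry at place \<open>i\<close> only, so that these two agree at all
  places whose parity differs from that of \<open>i\<close>. Permuting the two congruences gives
  \<open>w\<^sub>0 = z\<^sub>0, w\<^sub>1, \<dots>, w\<^sub>m\<^sub>+\<^sub>1 = z\<^sub>m\<^sub>+\<^sub>1\<close> where now \<open>w\<^sub>i\<close> and \<open>w\<^sub>i\<^sub>+\<^sub>1\<close> agree at the places with the
  parity of \<open>i\<close>, in particular at place \<open>i\<close> itself. So entry \<open>i\<close> of \<open>w\<^sub>i\<close> is entry \<open>i\<close> of \<open>w\<^sub>i\<^sub>+\<^sub>1\<close>,
  which is in relation \<open>E\<close> with entry \<open>i+1\<close> of \<open>w\<^sub>i\<^sub>+\<^sub>1\<close>, and the diagonal entries form an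
  \<open>E\<close>-chain with \<open>m\<close> steps from \<open>x\<^sub>0\<close> to \<open>x\<^sub>m\<^sub>+\<^sub>1\<close>.\<close>

lemma power_incl_if_permutable:
  assumes perm: "congruence_permutable (Suc m)" and X: "X \<in> Obj C" and E: "reflexive_rel X E"
  shows "incl (altprod X (Suc m) E E) (altprod X m E E)"
proof -
  note Er = reflexive_relD(1)[OF E]
  obtain Z p where Z: "Z \<in> Obj C" and p: "\<And>i. i \<le> m \<Longrightarrow> p i \<in> hom Z X"
    and pE: "\<And>i. i < m \<Longrightarrow> holds X E (p i) (p (Suc i))"
    and univ: "\<And>U x. (\<forall>i\<le>m. x i \<in> hom U X) \<Longrightarrow> (\<forall>i<m. holds X E (x i) (x (Suc i))) \<Longrightarrow>
       \<exists>u\<in>hom U Z. \<forall>i\<le>m. p i \<cdot> u = x i"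
    using chain_object[OF X, of m "\<lambda>_. E"] Er by blast
  have "\<exists>R. equivalence_rel Z R \<and> (\<forall>U. \<forall>u\<in>hom U Z. \<forall>v\<in>hom U Z. holds Z R u v \<longleftrightarrow>
    (\<forall>j<Suc m. even j = e \<longrightarrow> p j \<cdot> u = p j \<cdot> v))" for e
    by (rule agreement_equivalence[OF Z, of _ _ X]) (use p in simp)
  \<comment> \<open>\<open>A True\<close> is agreement at the even places, \<open>A False\<close> agreement at the odd ones.\<close>
  then obtain A where Aeq: "\<And>e. equivalence_rel Z (A e)"
    and A: "\<And>e U u v. u \<in> hom U Z \<Longrightarrow> v \<in> hom U Z \<Longrightarrow>
      holds Z (A e) u v \<longleftrightarrow> (\<forall>j<Suc m. even j = e \<longrightarrow> p j \<cdot> u = p j \<cdot> v)"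
    by metis
  have Ar: "A e \<in> rels Z" for e
    using Aeq[of e] unfolding equivalence_rel_def symmetric_rel_def by blast
  let ?P = "A (even (Suc m))" and ?Q = "A (even m)"
  have perm': "altprod Z (Suc m) ?P ?Q = altprod Z (Suc m) ?Q ?P"
    using perm Z Aeq unfolding congruence_permutable_def by blast
  show ?thesis
  proof (rule inclI[OF X altprod_rel[OF X Er Er] altprod_rel[OF X Er Er]])
    fix U a b assume a: "a \<in> hom U X" and b: "b \<in> hom U X" and h: "holds X (altprod X (Suc m) E E) a b"
    obtain c x where c: "cover c" "Cod C c = U" "c \<in> hom (Dom C c) U"
      and x: "\<And>i. i \<le> Suc m \<Longrightarrow> x i \<in> hom (Dom C c) X" "x 0 = a \<cdot> c" "x (Suc m) = b \<cdot> c"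
        "\<And>i. i < Suc m \<Longrightarrow> holds X E (x i) (x (Suc i))"
      using holds_altprodE[OF Er Er a b h] by auto
    note ac = comp_hom[OF c(3) a] and bc = comp_hom[OF c(3) b]
    have "\<exists>z\<in>hom (Dom C c) Z. \<forall>j\<le>m. p j \<cdot> z = (if j < i then x (Suc j) else x j)" for i
    proof (rule univ)
      show "\<forall>j\<le>m. (if j < i then x (Suc j) else x j) \<in> hom (Dom C c) X" using x(1) by simp
      show "\<forall>j<m. holds X E (if j < i then x (Suc j) else x j)
          (if Suc j < i then x (Suc (Suc j)) else x (Suc j))"
        using x(4) holds_refl[OF E x(1)] by auto
    qed
    then obtain z where z: "\<And>i. z i \<in> hom (Dom C c) Z"
      and pz: "\<And>i j. j \<le> m \<Longrightarrow> p j \<cdot> z i = (if j < i then x (Suc j) else x j)"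
      by metis
    have "holds Z (if odd (Suc m - i) then ?P else ?Q) (z i) (z (Suc i))" if i: "i < Suc m" for i
    proof -
      have "holds Z (A (odd i)) (z i) (z (Suc i))"
        unfolding A[OF z z]
      proof (intro allI impI)
        fix j assume "j < Suc m" "even j = odd i"
        then have "j \<le> m" "j \<noteq> i" by auto
        then show "p j \<cdot> z i = p j \<cdot> z (Suc i)" using pz by simp
      qed
      moreover have "(if odd (Suc m - i) then ?P else ?Q) = A (odd i)"
        using i by (auto intro!: arg_cong[where f = A])
      ultimately show ?thesis by simp
    qed
    then have "holds Z (altprod Z (Suc m) ?P ?Q) (z 0) (z (Suc m))"
      using holds_altprodI[where x = z and k = "Suc m", OF Ar Ar] z by blast
    then have hz: "holds Z (altprod Z (Suc m) ?Q ?P) (z 0) (z (Suc m))" using perm' by simp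
    obtain d w where d: "cover d" "Cod C d = Dom C c" "d \<in> hom (Dom C d) (Dom C c)"
      and w: "\<And>i. i \<le> Suc m \<Longrightarrow> w i \<in> hom (Dom C d) Z" "w 0 = z 0 \<cdot> d" "w (Suc m) = z (Suc m) \<cdot> d"
        "\<And>i. i < Suc m \<Longrightarrow> holds Z (if odd (Suc m - i) then ?Q else ?P) (w i) (w (Suc i))"
      using holds_altprodE[OF Ar Ar z z hz] by blast
    \<comment> \<open>After the swap the agreement is at the very place at which \<open>z\<close> changed.\<close>
    have step: "p i \<cdot> w i = p i \<cdot> w (Suc i)" if i: "i \<le> m" for i
    proof -
      have "(if odd (Suc m - i) then ?Q else ?P) = A (even i)"
        using i by (auto intro!: arg_cong[where f = A])
      then have "holds Z (A (even i)) (w i) (w (Suc i))" using w(4)[of i] i by simp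
      then show ?thesis using A[OF w(1)[of i] w(1)[of "Suc i"]] i by simp
    qed
    let ?y = "\<lambda>i. p i \<cdot> w i"
    have y: "?y i \<in> hom (Dom C d) X" if "i \<le> m" for i using that comp_hom[OF w(1) p] by simp
    have "holds X E (?y i) (?y (Suc i))" if i: "i < m" for i
    proof -
      have "holds X E (p i \<cdot> w (Suc i)) (p (Suc i) \<cdot> w (Suc i))"
        using holds_precomp[OF Er _ _ pE[OF i] w(1)] p i by simp
      then show ?thesis using step[of i] i by simp
    qed
    then have "holds X (altprod X m E E) (?y 0) (?y m)"
      using holds_altprodI[where x = ?y and k = m, OF Er Er y] by simp
    moreover have "?y 0 = a \<cdot> c \<cdot> d"
      using assoc[OF d(3) z[of 0] p[of 0]] pz[of 0 0] w(2) x(2) by simp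
    moreover have "?y m = b \<cdot> c \<cdot> d"
      using step[of m] assoc[OF d(3) z[of "Suc m"] p[of m]] pz[of m "Suc m"] w(3) x(3) by simp
    ultimately have "holds X (altprod X m E E) (a \<cdot> c \<cdot> d) (b \<cdot> c \<cdot> d)" by simp
    then show "holds X (altprod X m E E) a b"
      using holds_local[OF altprod_rel[OF X Er Er] a b c(1,2)]
        holds_local[OF altprod_rel[OF X Er Er] ac bc d(1,2)] by blast
  qed
qed

lemma altprod_absorb:
  assumes P: "transitive_rel X P" and Q: "Q \<in> rels X"
    and a: "a \<in> hom U X" and b: "b \<in> hom U X" and b': "b' \<in> hom U X"
    and h: "holds X (altprod X (Suc k) P Q) a b" and hP: "holds X P b b'"
  shows "holds X (altprod X (Suc k) P Q) a b'"
proof -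
  have X: "X \<in> Obj C" using homD[OF a] by simp
  have Pr: "P \<in> rels X" and i: "incl (relcomp X P P) P" using P unfolding transitive_rel_def by auto
  note W = altprod_rel[OF X Q Pr] and PP = relcomp_rel(1)[OF X Pr Pr]
  have "holds X (relcomp X P (relcomp X P (altprod X k Q P))) a b'"
    using holds_relcompI[OF altprod_rel[OF X Pr Q] Pr a b b' h hP] altprod_Suc[OF X Pr] by simp
  then have "holds X (relcomp X (relcomp X P P) (altprod X k Q P)) a b'"
    using relcomp_assoc[OF X W Pr Pr] by simp
  then show ?thesis
    using inclD[OF relcomp_mono[OF X W W PP Pr incl_refl[OF X W] i]
        relcomp_rel(1)[OF X W PP] relcomp_rel(1)[OF X W Pr] a b'] altprod_Suc[OF X Pr] by simp
qed

text \<open>Let \<open>v\<^sub>0 T\<^sub>0 v\<^sub>1 T\<^sub>1 \<dots> v\<^sub>m\<^sub>+\<^sub>1\<close> be a chain of steps alternating between \<open>R\<close> and \<open>S\<close>, and put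
  \<open>Q\<^sub>i = T\<^sub>i T\<^sub>i\<^sub>+\<^sub>1\<close> (a step in \<open>T\<^sub>i\<^sub>+\<^sub>1\<close>, then one in \<open>T\<^sub>i\<close>). On the object \<open>Z\<close> of chains with entries
  \<open>u\<^sub>0 Q\<^sub>0 u\<^sub>1 Q\<^sub>1 \<dots> u\<^sub>m\<close> let \<open>u E u'\<close> mean that \<open>u\<^sub>i Q\<^sub>i u'\<^sub>i\<^sub>+\<^sub>1\<close> for all \<open>i < m\<close>; this is
  reflexive by the choice of \<open>Z\<close>. The elements \<open>x\<^sub>j = (v\<^sub>1, \<dots>, v\<^sub>j, v\<^sub>j, \<dots>, v\<^sub>m)\<close> form an \<open>E\<close>-chain with
  \<open>m+1\<close> steps, since \<open>Q\<^sub>i\<close> contains \<open>T\<^sub>i\<close> as well as \<open>T\<^sub>i\<^sub>+\<^sub>1\<close>. A shorter \<open>E\<close>-chain \<open>t\<^sub>0, \<dots>, t\<^sub>m\<close> with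
  the same ends has a diagonal \<open>y\<^sub>i\<close> (entry \<open>i\<close> of \<open>t\<^sub>i\<close>) from \<open>v\<^sub>0\<close> to \<open>v\<^sub>m\<^sub>+\<^sub>1\<close> with \<open>y\<^sub>i Q\<^sub>i y\<^sub>i\<^sub>+\<^sub>1\<close>.
  Spelled out, its steps are in \<open>T\<^sub>1, T\<^sub>0, T\<^sub>2, T\<^sub>1, T\<^sub>3, T\<^sub>2, \<dots>\<close>; as \<open>T\<^sub>i\<^sub>+\<^sub>2 = T\<^sub>i\<close> is transitive, each
  \<open>T\<^sub>i T\<^sub>i\<^sub>+\<^sub>2\<close> merges into one step, and what is left are \<open>m+1\<close> alternating steps that begin in \<open>T\<^sub>1\<close>
  instead of \<open>T\<^sub>0\<close>.\<close>

lemma preorders_permute_if_power_incl: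
  assumes H: "\<And>Z E. Z \<in> Obj C \<Longrightarrow> reflexive_rel Z E \<Longrightarrow> incl (altprod Z (Suc m) E E) (altprod Z m E E)"
    and X: "X \<in> Obj C" and R: "preorder_rel X R" and S: "preorder_rel X S"
  shows "incl (altprod X (Suc m) R S) (altprod X (Suc m) S R)"
proof -
  have Rr: "R \<in> rels X" and Sr: "S \<in> rels X"
    using R S unfolding preorder_rel_def transitive_rel_def by auto
  \<comment> \<open>Step \<open>i\<close> is in \<open>R\<close> when \<open>m + 1 - i\<close> is odd; the formula with \<open>m + i\<close> has period two for all \<open>i\<close>.\<close>
  define T where "T i = (if even (m + i) then R else S)" for i
  have T: "T i \<in> rels X" "reflexive_rel X (T i)" "transitive_rel X (T i)" "T (Suc (Suc i)) = T i" for i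
    using R S Rr Sr unfolding T_def preorder_rel_def by auto
  define Q where "Q i = relcomp X (T i) (T (Suc i))" for i
  have Q: "Q i \<in> rels X" for i unfolding Q_def using relcomp_rel(1)[OF X T(1) T(1)] .
  have Q_T: "holds X (Q i) a b"
    if a: "a \<in> hom U X" and b: "b \<in> hom U X" and "holds X (T i) a b \<or> holds X (T (Suc i)) a b" for U a b i
    unfolding Q_def using that(3) holds_relcompI[OF T(1) T(1) a a b] holds_relcompI[OF T(1) T(1) a b b]
      holds_refl[OF T(2) a] holds_refl[OF T(2) b] by blast
  obtain Z p where Z: "Z \<in> Obj C" and p: "\<And>i. i \<le> m \<Longrightarrow> p i \<in> hom Z X"
    and pQ: "\<And>i. i < m \<Longrightarrow> holds X (Q i) (p i) (p (Suc i))"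
    and univ: "\<And>U x. (\<forall>i\<le>m. x i \<in> hom U X) \<Longrightarrow> (\<forall>i<m. holds X (Q i) (x i) (x (Suc i))) \<Longrightarrow>
       \<exists>u\<in>hom U Z. \<forall>i\<le>m. p i \<cdot> u = x i"
    using chain_object[OF X, of m Q] Q by blast
  have "\<exists>E\<in>rels Z. \<forall>U. \<forall>u\<in>hom U Z. \<forall>v\<in>hom U Z. holds Z E u v \<longleftrightarrow>
    (\<forall>j<m. True \<longrightarrow> holds X (Q j) (p j \<cdot> u) (p (Suc j) \<cdot> v))"
    by (rule rel_comprehension[OF Z]) (use p Q in simp)
  then obtain E where Er: "E \<in> rels Z" and E: "\<And>U u v. u \<in> hom U Z \<Longrightarrow> v \<in> hom U Z \<Longrightarrow>
    holds Z E u v \<longleftrightarrow> (\<forall>j<m. holds X (Q j) (p j \<cdot> u) (p (Suc j) \<cdot> v))"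
    by blast
  have Erefl: "reflexive_rel Z E"
  proof (rule reflexive_relI[OF Z Er])
    fix U u assume u: "u \<in> hom U Z"
    show "holds Z E u u"
      unfolding E[OF u u] using holds_precomp[OF Q _ _ pQ u] p by simp
  qed
  show ?thesis
  proof (rule inclI[OF X altprod_rel[OF X Rr Sr] altprod_rel[OF X Sr Rr]])
    fix U a b assume a: "a \<in> hom U X" and b: "b \<in> hom U X" and h: "holds X (altprod X (Suc m) R S) a b"
    obtain c v where c: "cover c" "Cod C c = U" "c \<in> hom (Dom C c) U"
      and v: "\<And>i. i \<le> Suc m \<Longrightarrow> v i \<in> hom (Dom C c) X" "v 0 = a \<cdot> c" "v (Suc m) = b \<cdot> c"
      and v': "\<And>i. i < Suc m \<Longrightarrow> holds X (if odd (Suc m - i) then R else S) (v i) (v (Suc i))"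
      using holds_altprodE[OF Rr Sr a b h] by blast
    note ac = comp_hom[OF c(3) a] and bc = comp_hom[OF c(3) b]
    have vT: "holds X (T i) (v i) (v (Suc i))" if "i \<le> m" for i
    proof -
      have "(if odd (Suc m - i) then R else S) = T i" using that unfolding T_def by auto
      then show ?thesis using v'[of i] that by simp
    qed
    have vQ: "holds X (Q i) (v i) (v (Suc i))" "holds X (Q i) (v (Suc i)) (v (Suc i))"
      "holds X (Q i) (v (Suc i)) (v (Suc (Suc i)))" if "i < m" for i
      using that Q_T[OF v(1) v(1)] vT[of i] vT[of "Suc i"] holds_refl[OF T(2) v(1)] by auto
    have "\<exists>x\<in>hom (Dom C c) Z. \<forall>i\<le>m. p i \<cdot> x = (if j \<le> i then v i else v (Suc i))" for j
    proof (rule univ)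
      show "\<forall>i\<le>m. (if j \<le> i then v i else v (Suc i)) \<in> hom (Dom C c) X" using v(1) by simp
      show "\<forall>i<m. holds X (Q i) (if j \<le> i then v i else v (Suc i))
          (if j \<le> Suc i then v (Suc i) else v (Suc (Suc i)))"
        using vQ by auto
    qed
    then obtain x where x: "\<And>j. x j \<in> hom (Dom C c) Z"
      and px: "\<And>i j. i \<le> m \<Longrightarrow> p i \<cdot> x j = (if j \<le> i then v i else v (Suc i))"
      by metis
    have "holds Z E (x j) (x (Suc j))" for j
      unfolding E[OF x x] using px vQ by auto
    then have "holds Z (altprod Z (Suc m) E E) (x 0) (x (Suc m))"
      using holds_altprodI[where x = x and k = "Suc m", OF Er Er x] by simp
    then have hx: "holds Z (altprod Z m E E) (x 0) (x (Suc m))"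
      using inclD[OF H[OF Z Erefl] altprod_rel[OF Z Er Er] altprod_rel[OF Z Er Er] x x] by blast
    obtain d t where d: "cover d" "Cod C d = Dom C c" "d \<in> hom (Dom C d) (Dom C c)"
      and t: "\<And>i. i \<le> m \<Longrightarrow> t i \<in> hom (Dom C d) Z" "t 0 = x 0 \<cdot> d" "t m = x (Suc m) \<cdot> d"
        "\<And>i. i < m \<Longrightarrow> holds Z E (t i) (t (Suc i))"
      using holds_altprodE[OF Er Er x x hx] by auto
    define y where "y i = p i \<cdot> t i" for i
    have y: "y i \<in> hom (Dom C d) X" if "i \<le> m" for i
      unfolding y_def using that comp_hom[OF t(1) p] by simp
    have yQ: "holds X (Q i) (y i) (y (Suc i))" if "i < m" for i
      unfolding y_def using t(4)[OF that] E[OF t(1) t(1)] that by simp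
    \<comment> \<open>For \<open>k = 0\<close> the only step, in \<open>T 1\<close>, is trivial; it absorbs the first step of \<open>Q 0\<close>.\<close>
    have "holds X (altprod X (Suc k) (T (Suc k)) (T k)) (y 0) (y k)" if "k \<le> m" for k
      using that
    proof (induction k)
      case 0
      then show ?case using holds_refl[OF T(2) y] by simp
    next
      case (Suc k)
      have yk: "y k \<in> hom (Dom C d) X" and yk': "y (Suc k) \<in> hom (Dom C d) X"
        and y0: "y 0 \<in> hom (Dom C d) X" using y Suc.prems by auto
      have hQ: "holds X (relcomp X (T k) (T (Suc k))) (y k) (y (Suc k))"
        using yQ[of k] Suc.prems unfolding Q_def by simp
      obtain e w where e: "cover e" "Cod C e = Dom C d" "e \<in> hom (Dom C e) (Dom C d)"
        and w: "w \<in> hom (Dom C e) X" "holds X (T (Suc k)) (y k \<cdot> e) w" "holds X (T k) w (y (Suc k) \<cdot> e)"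
        using holds_relcompE[OF T(1) T(1) yk yk' hQ] .
      let ?W = "altprod X (Suc k) (T (Suc k)) (T k)"
      note W = altprod_rel[OF X T(1) T(1), of "Suc k" "Suc k" k]
      have "holds X ?W (y 0 \<cdot> e) (y k \<cdot> e)"
        using holds_precomp[OF W y0 yk _ e(3)] Suc by simp
      then have "holds X ?W (y 0 \<cdot> e) w"
        using altprod_absorb[OF T(3) T(1) comp_hom[OF e(3) y0] comp_hom[OF e(3) yk] w(1) _ w(2)] by blast
      then have "holds X (relcomp X (T k) ?W) (y 0 \<cdot> e) (y (Suc k) \<cdot> e)"
        using holds_relcompI[OF W T(1) comp_hom[OF e(3) y0] w(1) comp_hom[OF e(3) yk'] _ w(3)] by blast
      then have "holds X (relcomp X (T k) ?W) (y 0) (y (Suc k))"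
        using holds_local[OF relcomp_rel(1)[OF X W T(1)] y0 yk' e(1,2)] by blast
      then show ?case using T(4)[of k] altprod_Suc[OF X T(1)] by simp
    qed
    then have "holds X (altprod X (Suc m) (T (Suc m)) (T m)) (y 0) (y m)" by blast
    moreover have "T (Suc m) = S" "T m = R" unfolding T_def by auto
    moreover have "y 0 = a \<cdot> c \<cdot> d"
      unfolding y_def using assoc[OF d(3) x[of 0] p[of 0]] px[of 0 0] t(2) v(2) by simp
    moreover have "y m = b \<cdot> c \<cdot> d"
      unfolding y_def using assoc[OF d(3) x[of "Suc m"] p[of m]] px[of m "Suc m"] t(3) v(3) by simp
    ultimately have "holds X (altprod X (Suc m) S R) (a \<cdot> c \<cdot> d) (b \<cdot> c \<cdot> d)" by simp
    then show "holds X (altprod X (Suc m) S R) a b"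
      using holds_local[OF altprod_rel[OF X Sr Rr] a b c(1,2)]
        holds_local[OF altprod_rel[OF X Sr Rr] ac bc d(1,2)] by blast
  qed
qed

section \<open>The equivalence\<close>

lemma congruence_permutable_iff_mixed_subpermutable:
  "congruence_permutable (Suc m) \<longleftrightarrow> mixed_subpermutable (Suc (2 * m))"
proof
  assume perm: "congruence_permutable (Suc m)"
  show "mixed_subpermutable (Suc (2 * m))"
    unfolding mixed_subpermutable_def
  proof (intro ballI allI impI, elim conjE)
    fix X R S assume X: "X \<in> Obj C" and "preorder_rel X R" and S: "reflexive_rel X S"
    then have R: "reflexive_rel X R" unfolding preorder_rel_def by blast
    note Rr = reflexive_relD(1)[OF R] and Sr = reflexive_relD(1)[OF S]
    let ?E = "relcomp X S R"
    have E: "reflexive_rel X ?E" by (rule reflexive_relcomp[OF X R S])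
    note A = altprod_rel[OF X Sr Rr]
    have "incl (altprod X (Suc (2 * m)) S R) (altprod X (2 * Suc m) S R)"
      using altprod_mono_Suc[OF X S R, of "Suc (2 * m)"] by simp
    moreover have "incl (altprod X (2 * Suc m) S R) (altprod X (2 * m) S R)"
      unfolding altprod_double[OF X Rr Sr] by (rule power_incl_if_permutable[OF perm X E])
    moreover have "incl (altprod X (2 * m) S R) (altprod X (Suc (2 * m)) R S)"
      unfolding altprod_Suc[OF X Rr] by (rule incl_relcomp_left[OF X R A])
    ultimately show "incl (altprod X (Suc (2 * m)) S R) (altprod X (Suc (2 * m)) R S)"
      using incl_trans[OF X] A altprod_rel[OF X Rr Sr] by metis
  qed
next
  assume mixed: "mixed_subpermutable (Suc (2 * m))"
  have H: "incl (altprod Z (Suc m) E E) (altprod Z m E E)" if Z: "Z \<in> Obj C" and E: "reflexive_rel Z E" for Z E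
  proof -
    note Er = reflexive_relD(1)[OF E] and D = diag_rel(1)[OF Z]
    have "preorder_rel Z (diag Z)"
      unfolding preorder_rel_def reflexive_rel_def transitive_rel_def
      using D incl_refl[OF Z D] relcomp_diag[OF Z D] by simp
    then have "incl (altprod Z (Suc (2 * m)) E (diag Z)) (altprod Z (Suc (2 * m)) (diag Z) E)"
      using mixed Z E unfolding mixed_subpermutable_def by blast
    \<comment> \<open>Deleting the factors \<open>\<Delta>\<close> leaves \<open>m + 1\<close> factors \<open>E\<close> on the one side and \<open>m\<close> on the other.\<close>
    moreover have "altprod Z (Suc (2 * m)) E (diag Z) = altprod Z (Suc m) E E"
      unfolding altprod_Suc[OF Z Er] altprod_double[OF Z Er D] relcomp_diag[OF Z Er] ..
    moreover have "altprod Z (Suc (2 * m)) (diag Z) E = altprod Z m E E"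
      unfolding altprod_Suc[OF Z D] altprod_double[OF Z D Er] relcomp_diag[OF Z Er]
      using relcomp_diag(2)[OF Z altprod_rel[OF Z Er Er]] .
    ultimately show ?thesis by simp
  qed
  show "congruence_permutable (Suc m)"
    unfolding congruence_permutable_def
  proof (intro ballI allI impI, elim conjE)
    fix X R S assume X: "X \<in> Obj C" and "equivalence_rel X R" "equivalence_rel X S"
    then have R: "preorder_rel X R" and S: "preorder_rel X S" unfolding equivalence_rel_def by auto
    then have Rr: "R \<in> rels X" and Sr: "S \<in> rels X" unfolding preorder_rel_def transitive_rel_def by auto
    show "altprod X (Suc m) R S = altprod X (Suc m) S R"
      using incl_antisym[OF altprod_rel[OF X Rr Sr] altprod_rel[OF X Sr Rr]]
        preorders_permute_if_power_incl[OF H X R S] preorders_permute_if_power_incl[OF H X S R] by blast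
  qed
qed

end

theorem theorem6p5:
  fixes E :: "('o, 'm) cat" and n :: nat
  assumes "regular_category E" and "n \<ge> 2"
  shows "category.congruence_permutable E n \<longleftrightarrow> category.mixed_subpermutable E (2 * n - 1)"
proof -
  interpret regular_category E by fact
  have "n = Suc (n - 1)" "2 * n - 1 = Suc (2 * (n - 1))" using assms(2) by auto
  then show ?thesis using congruence_permutable_iff_mixed_subpermutable[of "n - 1"] by simp
qed

end
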